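(* Let $F:\mathbb{R}^n\rightrightarrows\mathbb{R}^n$ be a multifunction such that: (i) $F(x)$ is nonempty, convex and compact for each $x\in\mathbb{R}^n$; (ii) $F$ is locally Lipschitz with respect to the Hausdorff metric; (iii) there exists $\rho>0$ with $\max\{|v|: v\in F(x)\}\le \rho(1+|x|)$ for all $x\in\mathbb{R}^n$. Let $H(x,p)=\sup_{v\in F(x)}\langle v,p\rangle$ and assume that for every nonempty, convex, compact $K\subset\mathbb{R}^n$: (iv) there exists $c\ge 0$ such that, for every $p\in\mathbb{R}^n$, the map $x\mapsto H(x,p)$ is semiconvex on $K$ with constant $c|p|$; (v) the gradient $\nabla_pH(x,p)$ exists for all $x\in K$, $p\neq 0$, and is locally Lipschitz in $x$ on $K$, uniformly over $p$ in any compact subset of $\mathbb{R}^n\smallsetminus\{0\}$. Let $\phi:\mathbb{R}^n\to\mathbb{R}$ be locally Lipschitz. Let $\overline{x}:[t_0,T]\to\mathbb{R}^n$ be an optimal solution of the Mayer problem $\mathcal{P}(t_0,x_0)$ and let $\overline{p}:[t_0,T]\to\mathbb{R}^n$ be any absolutely continuous solution of $$-\dot{\overline p}(t)\in\partial_x^-H(\overline{x}(t),\overline p(t)),\qquad \dot{\overline{x}}(t)\in\partial_pH(\overline{x}(t),\overline p(t))\qquad\text{for a.e. } t\in[t_0,T],$$ with the transversality condition $-\overline{p}(T)\in\partial^{+,pr}\phi(\overline{x}(T))$. Then there exist constants $c_0,r>0$ such that, for all $t\in[t_0,T]$ and all $h\in B(0,r)$, $$V(t,\overline{x}(t)+h)-V(t,\overline{x}(t))\le\langle-\overline{p}(t),h\rangle+c_0|h|^2.$$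 Consequently, $-\overline{p}(t)\in\partial_x^{+,pr}V(t,\overline{x}(t))$ for all $t\in[t_0,T]$.
   Context: $T>0$ is fixed, $|\cdot|$ is the Euclidean norm, $\langle\cdot,\cdot\rangle$ the inner product, $B(x,\epsilon)$ the closed ball of center $x$ and radius $\epsilon$. Mayer problem. For $(t_0,x_0)\in[0,T]\times\mathbb{R}^n$, a trajectory is an absolutely continuous $x:[t_0,T]\to\mathbb{R}^n$ with $\dot x(s)\in F(x(s))$ for a.e. $s\in[t_0,T]$ and $x(t_0)=x_0$. The problem $\mathcal{P}(t_0,x_0)$ is to minimize $\phi(x(T))$ over all such trajectories; an optimal solution is a trajectory attaining the infimum. The value function $V:[0,T]\times\mathbb{R}^n\to\mathbb{R}$ is $V(t_0,x_0)=\inf\phi(x(T))$, the infimum being over all trajectories with $x(t_0)=x_0$. Semiconvexity. $u$ is semiconvex on $K$ with constant $C$ if it is continuous there and $u(x+h)+u(x-h)-2u(x)\ge -C|h|^2$ for all $x,h$ with the segment $[x-h,x+h]\subset K$. Generalized differentials. For $f$ real-valued: the Fréchet subdifferential $\partial^-f(x)$ is the set of $p$ with $\liminf_{y\to x}\frac{f(y)-f(x)-\langle p,y-x\rangle}{|y-x|}\ge 0$; the proximal superdifferential $\partial^{+,pr}f(x)$ is the set of $p$ for which there are constants $c,\rho$ (with $\rho>0$) such that $f(y)-f(x)-\langle p,y-x\rangle\le c|y-x|^2$ for all $y\in B(x,\rho)$. $\partial_x^-H(x,p)$ is the Fréchet subdifferential of $H(\cdot,p)$ at $x$; $\partial_pH(x,p)$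 is Clarke's generalized gradient of $H(x,\cdot)$ at $p$; $\partial_x^{+,pr}V(t,x)$ is the proximal superdifferential of $V(t,\cdot)$ at $x$. *)

theory Defs
  imports "HOL-Analysis.Analysis"
begin

text \<open>Curves on an interval \<open>[a, b]\<close> are represented by total functions on the reals; every
  notion below only refers to their values on \<open>[a, b]\<close>.\<close>

definition absolutely_continuous_on :: "real \<Rightarrow> real \<Rightarrow> (real \<Rightarrow> 'a::metric_space) \<Rightarrow> bool" where
  "absolutely_continuous_on a b f \<longleftrightarrow>
    (\<forall>e>0. \<exists>d>0. \<forall>P. finite P \<longrightarrow> (\<forall>(u, v)\<in>P. a \<le> u \<and> u \<le> v \<and> v \<le> b) \<longrightarrow>
       disjoint_family_on (\<lambda>(u, v). {u<..<v}) P \<longrightarrow> (\<Sum>(u, v)\<in>P. v - u) < d \<longrightarrow>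
       (\<Sum>(u, v)\<in>P. dist (f u) (f v)) < e)"

definition locally_lipschitz :: "('a::metric_space \<Rightarrow> 'b::metric_space) \<Rightarrow> bool" where
  "locally_lipschitz f \<longleftrightarrow> (\<forall>x. \<exists>u>0. \<exists>L. L-lipschitz_on (cball x u) f)"

text \<open>The Hausdorff distance; only meaningful for nonempty bounded sets, since the real-valued
  supremum takes an unspecified value otherwise.\<close>

definition hausdorff_distance :: "'a::metric_space set \<Rightarrow> 'a set \<Rightarrow> real" where
  "hausdorff_distance A B = max (SUP a\<in>A. infdist a B) (SUP b\<in>B. infdist b A)"

definition locally_lipschitz_multifunction ::
    "('a::metric_space \<Rightarrow> 'b::metric_space set) \<Rightarrow> bool" where
  "locally_lipschitz_multifunction F \<longleftrightarrow>
    (\<forall>x. \<exists>u>0. \<exists>L\<ge>0. \<forall>y\<in>cball x u. \<forall>z\<in>cball x u.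
       hausdorff_distance (F y) (F z) \<le> L * dist y z)"

definition semiconvex_on :: "'a::real_normed_vector set \<Rightarrow> real \<Rightarrow> ('a \<Rightarrow> real) \<Rightarrow> bool" where
  "semiconvex_on K C u \<longleftrightarrow> continuous_on K u \<and>
    (\<forall>x h. closed_segment (x - h) (x + h) \<subseteq> K \<longrightarrow>
       u (x + h) + u (x - h) - 2 * u x \<ge> - C * (norm h)\<^sup>2)"

text \<open>Unspecified where the function is not differentiable.\<close>

definition gradient :: "('a::real_inner \<Rightarrow> real) \<Rightarrow> 'a \<Rightarrow> 'a" where
  "gradient f x = (THE D. GDERIV f x :> D)"

definition frechet_subdifferential :: "('a::real_inner \<Rightarrow> real) \<Rightarrow> 'a \<Rightarrow> 'a set" where
  "frechet_subdifferential f x =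
    {p. Liminf (at x) (\<lambda>y. ereal ((f y - f x - p \<bullet> (y - x)) / norm (y - x))) \<ge> 0}"

definition proximal_superdifferential :: "('a::real_inner \<Rightarrow> real) \<Rightarrow> 'a \<Rightarrow> 'a set" where
  "proximal_superdifferential f x =
    {p. \<exists>c. \<exists>\<rho>>0. \<forall>y\<in>cball x \<rho>. f y - f x - p \<bullet> (y - x) \<le> c * (norm (y - x))\<^sup>2}"

text \<open>Clarke's generalized directional derivative: the upper limit of
  \<open>(f (y + h v) - f y) / h\<close> as \<open>y\<close> tends to \<open>x\<close> (with \<open>y = x\<close> allowed) and \<open>h\<close> decreases to
  \<open>0\<close>. It is finite when \<open>f\<close> is Lipschitz near \<open>x\<close>.\<close>

definition clarke_derivative :: "('a::real_inner \<Rightarrow> real) \<Rightarrow> 'a \<Rightarrow> 'a \<Rightarrow> ereal" where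
  "clarke_derivative f x v =
    Limsup (nhds x \<times>\<^sub>F at_right 0) (\<lambda>(y, h). ereal ((f (y + h *\<^sub>R v) - f y) / h))"

definition clarke_gradient :: "('a::real_inner \<Rightarrow> real) \<Rightarrow> 'a \<Rightarrow> 'a set" where
  "clarke_gradient f x = {\<xi>. \<forall>v. ereal (\<xi> \<bullet> v) \<le> clarke_derivative f x v}"

definition hamiltonian :: "('a::real_inner \<Rightarrow> 'a set) \<Rightarrow> 'a \<Rightarrow> 'a \<Rightarrow> real" where
  "hamiltonian F x p = (SUP v\<in>F x. v \<bullet> p)"

definition trajectory ::
    "('a::euclidean_space \<Rightarrow> 'a set) \<Rightarrow> real \<Rightarrow> real \<Rightarrow> 'a \<Rightarrow> (real \<Rightarrow> 'a) \<Rightarrow> bool" where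
  "trajectory F T t0 x0 x \<longleftrightarrow>
    absolutely_continuous_on t0 T x \<and> x t0 = x0 \<and>
    (AE s in lebesgue. s \<in> {t0..T} \<longrightarrow>
       (\<exists>v\<in>F (x s). (x has_vector_derivative v) (at s within {t0..T})))"

definition optimal_solution ::
    "('a::euclidean_space \<Rightarrow> 'a set) \<Rightarrow> ('a \<Rightarrow> real) \<Rightarrow> real \<Rightarrow> real \<Rightarrow> 'a \<Rightarrow> (real \<Rightarrow> 'a) \<Rightarrow> bool"
  where
  "optimal_solution F \<phi> T t0 x0 x \<longleftrightarrow>
    trajectory F T t0 x0 x \<and> (\<forall>y. trajectory F T t0 x0 y \<longrightarrow> \<phi> (x T) \<le> \<phi> (y T))"

text \<open>The infimum is that of the reals: it is meaningful if some trajectory starts at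
  \<open>(t0, x0)\<close> and the final costs are bounded below, as is the case for a locally Lipschitz
  multifunction of linear growth with nonempty compact convex values and a continuous cost.\<close>

definition value_function ::
    "('a::euclidean_space \<Rightarrow> 'a set) \<Rightarrow> ('a \<Rightarrow> real) \<Rightarrow> real \<Rightarrow> real \<Rightarrow> 'a \<Rightarrow> real" where
  "value_function F \<phi> T t0 x0 = Inf {\<phi> (x T) | x. trajectory F T t0 x0 x}"

end

theory Submission
  imports Defs
begin

text \<open>By dynamic programming \<open>V(t, xbar t) = \<phi>(xbar T)\<close>, and \<open>V(t, xbar t + h) \<le> \<phi>(y T)\<close> for every trajectory
  \<open>y\<close> from \<open>xbar t + h\<close>. The velocity of \<open>y\<close> is chosen in \<open>F(y)\<close> so as to maximize \<open>\<langle>\<cdot>, pbar\<rangle>\<close>, with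
  \<open>\<bar>y - xbar\<bar> = O(\<bar>h\<bar>)\<close>. Then the semiconvexity of \<open>H\<close> in \<open>x\<close> bounds the derivative of
  \<open>\<langle>-pbar, y - xbar\<rangle>\<close> by a multiple of \<open>\<bar>h\<bar>\<^sup>2\<close>, which carries the transversality condition from \<open>T\<close>
  back to \<open>t\<close>. As \<open>\<bar>pbar'\<bar> \<le> m \<bar>pbar\<bar>\<close>, the arc \<open>pbar\<close> either never vanishes, and \<open>y' = \<nabla>\<^sub>p H(y, pbar)\<close>
  has a Lipschitz right-hand side, or is identically zero, and \<open>y\<close> is given by Filippov's theorem. Both
  cases are instances of one scheme of successive approximations.\<close>

section \<open>Absolutely continuous functions\<close>

lemma absolutely_continuous_onE:
  assumes "absolutely_continuous_on a b f" "e > 0"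
  obtains \<delta> where "\<delta> > 0"
    "\<forall>P. finite P \<longrightarrow> (\<forall>(u, v)\<in>P. a \<le> u \<and> u \<le> v \<and> v \<le> b) \<longrightarrow>
       disjoint_family_on (\<lambda>(u, v). {u<..<v}) P \<longrightarrow> (\<Sum>(u, v)\<in>P. v - u) < \<delta> \<longrightarrow>
       (\<Sum>(u, v)\<in>P. dist (f u) (f v)) < e"
  by (rule exE[OF mp[OF spec[OF assms(1)[unfolded absolutely_continuous_on_def]] assms(2)]])
     (rule that, (erule conjunct1 conjunct2)+)

lemma absolutely_continuous_on_subinterval:
  assumes "absolutely_continuous_on a b f" "a \<le> c" "d \<le> b"
  shows "absolutely_continuous_on c d f"
  unfolding absolutely_continuous_on_def
proof (intro allI impI)
  fix e :: real assume "e > 0"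
  obtain \<delta> where "\<delta> > 0" and \<delta>: "\<forall>P. finite P \<longrightarrow> (\<forall>(u, v)\<in>P. a \<le> u \<and> u \<le> v \<and> v \<le> b) \<longrightarrow>
       disjoint_family_on (\<lambda>(u, v). {u<..<v}) P \<longrightarrow> (\<Sum>(u, v)\<in>P. v - u) < \<delta> \<longrightarrow>
       (\<Sum>(u, v)\<in>P. dist (f u) (f v)) < e"
    by (rule absolutely_continuous_onE[OF assms(1) \<open>e > 0\<close>])
  show "\<exists>\<delta>>0. \<forall>P. finite P \<longrightarrow> (\<forall>(u, v)\<in>P. c \<le> u \<and> u \<le> v \<and> v \<le> d) \<longrightarrow>
       disjoint_family_on (\<lambda>(u, v). {u<..<v}) P \<longrightarrow> (\<Sum>(u, v)\<in>P. v - u) < \<delta> \<longrightarrow>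
       (\<Sum>(u, v)\<in>P. dist (f u) (f v)) < e"
  proof (intro exI[of _ \<delta>] conjI allI impI)
    fix P :: "(real \<times> real) set"
    assume P: "finite P" "\<forall>(u, v)\<in>P. c \<le> u \<and> u \<le> v \<and> v \<le> d"
      "disjoint_family_on (\<lambda>(u, v). {u<..<v}) P" "(\<Sum>(u, v)\<in>P. v - u) < \<delta>"
    have "\<forall>(u, v)\<in>P. a \<le> u \<and> u \<le> v \<and> v \<le> b"
      using P(2) assms(2,3) by fastforce
    then show "(\<Sum>(u, v)\<in>P. dist (f u) (f v)) < e"
      using P by (intro \<delta>[THEN spec, THEN mp, THEN mp, THEN mp, THEN mp])
  qed (fact \<open>\<delta> > 0\<close>)
qed

lemma lipschitz_on_imp_absolutely_continuous_on:
  fixes f :: "real \<Rightarrow> 'a::metric_space"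
  assumes L: "L-lipschitz_on {a..b} f"
  shows "absolutely_continuous_on a b f"
  unfolding absolutely_continuous_on_def
proof (intro allI impI)
  fix e :: real assume "e > 0"
  have "L \<ge> 0"
    using L lipschitz_on_nonneg by blast
  show "\<exists>\<delta>>0. \<forall>P. finite P \<longrightarrow> (\<forall>(u, v)\<in>P. a \<le> u \<and> u \<le> v \<and> v \<le> b) \<longrightarrow>
       disjoint_family_on (\<lambda>(u, v). {u<..<v}) P \<longrightarrow> (\<Sum>(u, v)\<in>P. v - u) < \<delta> \<longrightarrow>
       (\<Sum>(u, v)\<in>P. dist (f u) (f v)) < e"
  proof (intro exI[of _ "e / (L + 1)"] conjI allI impI)
    show "e / (L + 1) > 0"
      using \<open>e > 0\<close> \<open>L \<ge> 0\<close> by simp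
    fix P :: "(real \<times> real) set"
    assume P: "finite P" "\<forall>(u, v)\<in>P. a \<le> u \<and> u \<le> v \<and> v \<le> b"
      and small: "(\<Sum>(u, v)\<in>P. v - u) < e / (L + 1)"
    have "(\<Sum>(u, v)\<in>P. dist (f u) (f v)) \<le> (\<Sum>(u, v)\<in>P. L * (v - u))"
    proof (rule sum_mono, safe)
      fix u v assume "(u, v) \<in> P"
      then show "dist (f u) (f v) \<le> L * (v - u)"
        using lipschitz_onD[OF L, of u v] P(2) by (auto simp: dist_real_def)
    qed
    also have "\<dots> = L * (\<Sum>(u, v)\<in>P. v - u)"
      by (simp add: sum_distrib_left case_prod_unfold)
    also have "\<dots> \<le> (L + 1) * (\<Sum>(u, v)\<in>P. v - u)"
      using P(2) by (intro mult_right_mono sum_nonneg) auto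
    also have "\<dots> < e"
      using small \<open>L \<ge> 0\<close> by (simp add: field_simps)
    finally show "(\<Sum>(u, v)\<in>P. dist (f u) (f v)) < e" .
  qed
qed

lemma absolutely_continuous_on_imp_continuous_on:
  fixes f :: "real \<Rightarrow> 'a::metric_space"
  assumes "absolutely_continuous_on a b f"
  shows "continuous_on {a..b} f"
  unfolding continuous_on_iff
proof (intro ballI allI impI)
  fix s and e :: real assume s: "s \<in> {a..b}" and "e > 0"
  obtain \<delta> where "\<delta> > 0" and \<delta>: "\<forall>P. finite P \<longrightarrow> (\<forall>(u, v)\<in>P. a \<le> u \<and> u \<le> v \<and> v \<le> b) \<longrightarrow>
       disjoint_family_on (\<lambda>(u, v). {u<..<v}) P \<longrightarrow> (\<Sum>(u, v)\<in>P. v - u) < \<delta> \<longrightarrow>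
       (\<Sum>(u, v)\<in>P. dist (f u) (f v)) < e"
    by (rule absolutely_continuous_onE[OF assms \<open>e > 0\<close>])
  show "\<exists>\<delta>>0. \<forall>t\<in>{a..b}. dist t s < \<delta> \<longrightarrow> dist (f t) (f s) < e"
  proof (intro exI[of _ \<delta>] conjI ballI impI)
    fix t assume "t \<in> {a..b}" "dist t s < \<delta>"
    then show "dist (f t) (f s) < e"
      using \<delta>[THEN spec, of "{(min s t, max s t)}"] s
      by (cases "s \<le> t") (auto simp: disjoint_family_on_def dist_real_def dist_commute min_def max_def)
  qed (fact \<open>\<delta> > 0\<close>)
qed

text \<open>The tags in the exceptional null set contribute little: their intervals are kept inside a
  small open set, on which absolute continuity controls the increments. The other tags are
  treated as in the fundamental theorem of calculus.\<close>

lemma absolutely_continuous_on_has_integral: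
  fixes f :: "real \<Rightarrow> 'a::banach"
  assumes "a \<le> b" and ac: "absolutely_continuous_on a b f" and N: "negligible N"
    and f': "\<And>s. s \<in> {a..b} - N \<Longrightarrow> (f has_vector_derivative f' s) (at s within {a..b})"
  shows "(f' has_integral (f b - f a)) {a..b}"
proof -
  define g where "g s = (if s \<in> N then 0 else f' s)" for s
  have "(g has_integral (f b - f a)) {a..b}"
    unfolding has_integral_real
  proof (intro allI impI)
    fix e :: real assume "e > 0"
    define e1 where "e1 = e / (2 * (b - a + 1))"
    have "e1 > 0"
      using \<open>e > 0\<close> \<open>a \<le> b\<close> by (simp add: e1_def)
    have e1: "e1 * (b - a) < e / 2"
      using \<open>e > 0\<close> \<open>a \<le> b\<close> by (simp add: e1_def field_simps)
    obtain \<delta> where "\<delta> > 0" and \<delta>: "\<forall>P. finite P \<longrightarrow> (\<forall>(u, v)\<in>P. a \<le> u \<and> u \<le> v \<and> v \<le> b) \<longrightarrow>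
       disjoint_family_on (\<lambda>(u, v). {u<..<v}) P \<longrightarrow> (\<Sum>(u, v)\<in>P. v - u) < \<delta> \<longrightarrow>
       (\<Sum>(u, v)\<in>P. dist (f u) (f v)) < e / 2"
      by (rule absolutely_continuous_onE[OF ac half_gt_zero[OF \<open>e > 0\<close>]])
    have Nl: "N \<in> null_sets lebesgue"
      using N negligible_iff_null_sets by blast
    then obtain U where U: "open U" "N \<subseteq> U" "U - N \<in> lmeasurable"
        "emeasure lebesgue (U - N) < ennreal \<delta>"
      using sets_lebesgue_outer_open[of N \<delta>] \<open>\<delta> > 0\<close> by blast
    have Ulm: "U \<in> lmeasurable"
      using U Nl by (metis borel_open fmeasurableI_null_sets fmeasurable.Un Un_Diff_cancel2 sup.absorb1)
    have "emeasure lebesgue U < ennreal \<delta>"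
      using U(4) emeasure_Diff_null_set[OF Nl] Ulm by (simp add: fmeasurableD)
    then have Um: "measure lebesgue U < \<delta>"
      using Ulm by (simp add: emeasure_eq_measure2 ennreal_less_iff)
    have "\<exists>d>0. s \<in> {a..b} - N \<longrightarrow> (\<forall>y\<in>{a..b}. norm (y - s) < d \<longrightarrow>
           norm (f y - f s - (y - s) *\<^sub>R f' s) \<le> e1 * norm (y - s))" for s
      using f'[of s] \<open>e1 > 0\<close> unfolding has_vector_derivative_def has_derivative_within_alt
      by (metis zero_less_one)
    then obtain d where d: "\<And>s. d s > 0"
      "\<And>s y. s \<in> {a..b} - N \<Longrightarrow> y \<in> {a..b} \<Longrightarrow> norm (y - s) < d s \<Longrightarrow>
         norm (f y - f s - (y - s) *\<^sub>R f' s) \<le> e1 * norm (y - s)"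
      by metis
    define \<gamma> where "\<gamma> s = (if s \<in> N then U else ball s (d s))" for s
    have "gauge \<gamma>"
      using U d(1) by (auto simp: gauge_def \<gamma>_def)
    moreover have "norm ((\<Sum>(x, K)\<in>p. measure lborel K *\<^sub>R g x) - (f b - f a)) < e"
      if ptag: "p tagged_division_of {a..b}" and fine: "\<gamma> fine p" for p
    proof -
      have ptag': "p tagged_division_of (cbox a b)"
        using ptag by simp
      have pfin: "finite p"
        using ptag by blast
      have ba: "b - a = (\<Sum>(x,K)\<in>p. Sup K - Inf K)"
        and fba: "f b - f a = (\<Sum>(x,K)\<in>p. f(Sup K) - f(Inf K))"
        using additive_tagged_division_1[where f= "\<lambda>x. x"] additive_tagged_division_1[where f= f]
              \<open>a \<le> b\<close> ptag' by auto
      have int: "\<exists>u v. K = {u..v} \<and> a \<le> u \<and> u \<le> v \<and> v \<le> b \<and> x \<in> {u..v}" if "(x, K) \<in> p" for x K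
      proof -
        have "x \<in> K" "K \<subseteq> {a..b}" "\<exists>u v. K = cbox u v"
          using tagged_division_ofD[OF ptag] that by auto
        then show ?thesis
          by auto
      qed
      define B where "B = {(x, K) \<in> p. x \<in> N}"
      define D where "D = snd ` B"
      have Bp: "B \<subseteq> p"
        by (auto simp: B_def)
      have Btag: "B tagged_partial_division_of {a..b}"
        using ptag Bp tagged_partial_division_subset unfolding tagged_division_of_def by blast
      have Dint: "\<exists>u v. K = {u..v} \<and> a \<le> u \<and> u \<le> v \<and> v \<le> b" if "K \<in> D" for K
        using that Bp int unfolding D_def by fastforce
      have Ddiv: "D division_of \<Union>D"
        unfolding D_def by (rule partial_division_of_tagged_division[OF Btag])
      have Dfin: "finite D"
        using Ddiv by blast
      have inj: "inj_on (\<lambda>K. (Inf K, Sup K)) D"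
      proof (rule inj_onI)
        fix K K' assume "K \<in> D" "K' \<in> D" and eq: "(Inf K, Sup K) = (Inf K', Sup K')"
        then obtain u v u' v' where "K = {u..v}" "u \<le> v" "K' = {u'..v'}" "u' \<le> v'"
          using Dint by meson
        with eq show "K = K'"
          by simp
      qed
      have bad: "(\<Sum>(x, K)\<in>B. dist (f (Inf K)) (f (Sup K))) < e / 2"
      proof -
        define P where "P = (\<lambda>K. (Inf K, Sup K)) ` D"
        have sumP: "(\<Sum>(u, v)\<in>P. h u v) = (\<Sum>K\<in>D. h (Inf K) (Sup K))" for h :: "real \<Rightarrow> real \<Rightarrow> real"
          unfolding P_def by (subst sum.reindex[OF inj]) simp
        have "(\<Sum>(x, K)\<in>B. dist (f (Inf K)) (f (Sup K)))
            = (\<Sum>(x, K)\<in>B. if K = {} then 0 else dist (f (Inf K)) (f (Sup K)))"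
        proof (rule sum.cong)
          fix i assume "i \<in> B"
          moreover obtain x K where "i = (x, K)"
            by fastforce
          ultimately show "(case i of (x, K) \<Rightarrow> dist (f (Inf K)) (f (Sup K))) =
              (case i of (x, K) \<Rightarrow> if K = {} then 0 else dist (f (Inf K)) (f (Sup K)))"
            using Bp int[of x K] by auto
        qed simp
        also have "\<dots> = (\<Sum>K\<in>D. if K = {} then 0 else dist (f (Inf K)) (f (Sup K)))"
          unfolding D_def
        proof (rule sum.over_tagged_division_lemma[OF tagged_partial_division_of_Union_self[OF Btag]])
          fix u v :: real assume "box u v = {}"
          then show "(if cbox u v = {} then 0 else dist (f (Inf (cbox u v))) (f (Sup (cbox u v)))) = 0"
            by (cases "u = v") auto
        qed
        also have "\<dots> = (\<Sum>K\<in>D. dist (f (Inf K)) (f (Sup K)))"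
          using division_ofD(3)[OF Ddiv] by (intro sum.cong) auto
        also have "\<dots> = (\<Sum>(u, v)\<in>P. dist (f u) (f v))"
          by (rule sumP[symmetric])
        also have "\<dots> < e / 2"
        proof (rule \<delta>[THEN spec, THEN mp, THEN mp, THEN mp, THEN mp])
          show "finite P"
            using Dfin by (simp add: P_def)
          show "\<forall>(u, v)\<in>P. a \<le> u \<and> u \<le> v \<and> v \<le> b"
            using Dint unfolding P_def by fastforce
          show "disjoint_family_on (\<lambda>(u, v). {u<..<v}) P"
            unfolding disjoint_family_on_def P_def
          proof (intro ballI impI, elim imageE, simp only:)
            fix K K' assume K: "K \<in> D" "K' \<in> D" "(Inf K, Sup K) \<noteq> (Inf K', Sup K')"
            then have "interior K \<inter> interior K' = {}"
              using division_ofD(5)[OF Ddiv] by blast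
            moreover obtain u v u' v' where "K = {u..v}" "u \<le> v" "K' = {u'..v'}" "u' \<le> v'"
              using Dint K by meson
            ultimately show "(case (Inf K, Sup K) of (u, v) \<Rightarrow> {u<..<v}) \<inter>
                (case (Inf K', Sup K') of (u, v) \<Rightarrow> {u<..<v}) = {}"
              by (simp add: interior_atLeastAtMost_real)
          qed
          have "(\<Sum>(u, v)\<in>P. v - u) = (\<Sum>K\<in>D. Sup K - Inf K)"
            by (rule sumP)
          also have "\<dots> = (\<Sum>K\<in>D. measure lborel K)"
          proof (rule sum.cong)
            fix K assume "K \<in> D"
            then show "Sup K - Inf K = measure lborel K"
              using Dint by fastforce
          qed simp
          also have "\<dots> = measure lebesgue (\<Union>D)"
          proof -
            have "measure lborel K = measure lebesgue K" if "K \<in> D" for K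
              using Dint[OF that] by (auto simp: measure_completion)
            then show ?thesis
              using content_division[OF Ddiv] by (simp cong: sum.cong)
          qed
          also have "\<dots> \<le> measure lebesgue U"
          proof (rule measure_mono_fmeasurable)
            show "\<Union>D \<subseteq> U"
              using fine unfolding fine_def D_def B_def \<gamma>_def by fastforce
            show "\<Union>D \<in> sets lebesgue"
              using Ddiv lmeasurable_division by (blast intro: fmeasurableD)
          qed (fact Ulm)
          finally show "(\<Sum>(u, v)\<in>P. v - u) < \<delta>"
            using Um by simp
        qed
        finally show ?thesis .
      qed
      have good: "norm (measure lborel K *\<^sub>R g x - (f (Sup K) - f (Inf K))) \<le> e1 * (Sup K - Inf K)"
        if "(x, K) \<in> p - B" for x K
      proof -
        have xK: "(x, K) \<in> p" "x \<notin> N"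
          using that by (auto simp: B_def)
        then obtain u v where K: "K = {u..v}" "a \<le> u" "u \<le> v" "v \<le> b" "x \<in> {u..v}"
          using int by blast
        have "K \<subseteq> ball x (d x)"
          using fine xK unfolding fine_def \<gamma>_def by fastforce
        then have "u \<in> ball x (d x)" "v \<in> ball x (d x)"
          using K(1,3) by (auto simp del: mem_ball)
        then have "norm (f u - f x - (u - x) *\<^sub>R f' x) \<le> e1 * norm (u - x)"
          and "norm (f v - f x - (v - x) *\<^sub>R f' x) \<le> e1 * norm (v - x)"
          using d(2)[of x u] d(2)[of x v] K xK by (auto simp: dist_real_def)
        moreover have "(v - u) *\<^sub>R f' x - (f v - f u)
            = (f u - f x - (u - x) *\<^sub>R f' x) - (f v - f x - (v - x) *\<^sub>R f' x)"
          by (simp add: algebra_simps)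
        ultimately have "norm ((v - u) *\<^sub>R f' x - (f v - f u)) \<le> e1 * norm (u - x) + e1 * norm (v - x)"
          by (metis norm_triangle_le_diff add_mono)
        also have "\<dots> = e1 * (v - u)"
          using K by (simp add: algebra_simps)
        finally show ?thesis
          using K xK by (simp add: g_def)
      qed
      have "norm ((\<Sum>(x, K)\<in>p. measure lborel K *\<^sub>R g x) - (f b - f a))
          = norm (\<Sum>(x, K)\<in>p. measure lborel K *\<^sub>R g x - (f (Sup K) - f (Inf K)))"
        unfolding fba by (simp add: case_prod_unfold sum_subtractf)
      also have "\<dots> \<le> (\<Sum>(x, K)\<in>p. norm (measure lborel K *\<^sub>R g x - (f (Sup K) - f (Inf K))))"
        unfolding case_prod_unfold by (rule norm_sum)
      also have "\<dots> = (\<Sum>(x, K)\<in>p - B. norm (measure lborel K *\<^sub>R g x - (f (Sup K) - f (Inf K))))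
          + (\<Sum>(x, K)\<in>B. norm (measure lborel K *\<^sub>R g x - (f (Sup K) - f (Inf K))))"
        by (rule sum.subset_diff[OF Bp pfin])
      also have "\<dots> \<le> (\<Sum>(x, K)\<in>p - B. e1 * (Sup K - Inf K)) + (\<Sum>(x, K)\<in>B. dist (f (Inf K)) (f (Sup K)))"
      proof (rule add_mono; rule sum_mono)
        show "(case i of (x, K) \<Rightarrow> norm (measure lborel K *\<^sub>R g x - (f (Sup K) - f (Inf K))))
            \<le> (case i of (x, K) \<Rightarrow> e1 * (Sup K - Inf K))" if "i \<in> p - B" for i
          using that good by (cases i) auto
        show "(case i of (x, K) \<Rightarrow> norm (measure lborel K *\<^sub>R g x - (f (Sup K) - f (Inf K))))
            \<le> (case i of (x, K) \<Rightarrow> dist (f (Inf K)) (f (Sup K)))" if "i \<in> B" for i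
          using that by (auto simp: B_def g_def dist_norm norm_minus_commute)
      qed
      also have "\<dots> \<le> (\<Sum>(x, K)\<in>p. e1 * (Sup K - Inf K)) + (\<Sum>(x, K)\<in>B. dist (f (Inf K)) (f (Sup K)))"
      proof (intro add_right_mono sum_mono2)
        fix i assume "i \<in> p - (p - B)"
        then show "0 \<le> (case i of (x, K) \<Rightarrow> e1 * (Sup K - Inf K))"
          using int \<open>e1 > 0\<close> by (cases i) fastforce
      qed (use pfin in auto)
      also have "(\<Sum>(x, K)\<in>p. e1 * (Sup K - Inf K)) = e1 * (b - a)"
        unfolding ba by (simp add: sum_distrib_left case_prod_unfold)
      also have "e1 * (b - a) + (\<Sum>(x, K)\<in>B. dist (f (Inf K)) (f (Sup K))) < e"
        using e1 bad by simp
      finally show ?thesis .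
    qed
    ultimately show "\<exists>\<gamma>. gauge \<gamma> \<and> (\<forall>p. p tagged_division_of {a..b} \<and> \<gamma> fine p \<longrightarrow>
        norm ((\<Sum>(x, K)\<in>p. measure lborel K *\<^sub>R g x) - (f b - f a)) < e)"
      by (intro exI[of _ \<gamma>]) auto
  qed
  then show ?thesis
    by (rule has_integral_spike[OF N, rotated]) (simp add: g_def)
qed

lemma has_vector_derivative_integral_ae:
  fixes v :: "real \<Rightarrow> 'a::euclidean_space"
  assumes v: "v integrable_on {a..b}"
  obtains N where "negligible N"
    "\<And>s. s \<in> {a..b} - N \<Longrightarrow> ((\<lambda>s. integral {a..s} v) has_vector_derivative v s) (at s within {a..b})"
proof -
  define w where "w s = (if s \<in> {a..b} then v s else 0)" for s
  have wU: "w integrable_on UNIV"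
    unfolding w_def using v by (simp only: integrable_restrict_UNIV)
  have w: "w integrable_on cbox c d" for c d :: real
    using integrable_on_subcbox[OF wU] by blast
  define w' where "w' s = w (- s)" for s
  have w': "w' integrable_on cbox c d" for c d :: real
    using w[of "-d" "-c"] Henstock_Kurzweil_Integration.integrable_reflect_real[where f = w and a = "-d" and b = "-c"] unfolding w'_def by simp
  obtain N1 where N1: "negligible N1" "\<And>x e. \<lbrakk>x \<notin> N1; 0 < e\<rbrakk> \<Longrightarrow>
      \<exists>d>0. \<forall>h. 0 < h \<and> h < d \<longrightarrow> norm(integral (cbox x (x + h *\<^sub>R One)) w /\<^sub>R h ^ DIM(real) - w x) < e"
    using integrable_ccontinuous_explicit[OF w] by blast
  obtain N2 where N2: "negligible N2" "\<And>x e. \<lbrakk>x \<notin> N2; 0 < e\<rbrakk> \<Longrightarrow>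
      \<exists>d>0. \<forall>h. 0 < h \<and> h < d \<longrightarrow> norm(integral (cbox x (x + h *\<^sub>R One)) w' /\<^sub>R h ^ DIM(real) - w' x) < e"
    using integrable_ccontinuous_explicit[OF w'] by blast
  define N where "N = N1 \<union> uminus ` N2"
  have "negligible (uminus ` N2)"
  proof (rule negligible_locally_Lipschitz_image[OF _ N2(1)])
    fix x :: real
    show "\<exists>T B. open T \<and> x \<in> T \<and> (\<forall>y\<in>N2 \<inter> T. norm (- y - - x) \<le> B * norm (y - x))"
      by (intro exI[of _ UNIV] exI[of _ 1]) auto
  qed simp
  then have "negligible N"
    using N1(1) by (simp add: N_def)
  moreover have "((\<lambda>s. integral {a..s} v) has_vector_derivative v s) (at s within {a..b})"
    if s: "s \<in> {a..b} - N" for s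
    unfolding has_vector_derivative_def has_derivative_within_alt
  proof (intro conjI allI impI)
    show "bounded_linear (\<lambda>x. x *\<^sub>R v s)"
      by (rule bounded_linear_scaleR_left)
    fix e :: real assume "e > 0"
    have "s \<notin> N1" "- s \<notin> N2"
      using s by (auto simp: N_def image_iff)
    obtain d1 where d1: "d1 > 0" "\<And>h. 0 < h \<Longrightarrow> h < d1 \<Longrightarrow> norm (integral {s..s + h} w /\<^sub>R h - w s) < e"
      using N1(2)[OF \<open>s \<notin> N1\<close> \<open>e > 0\<close>] by auto
    obtain d2 where d2: "d2 > 0" "\<And>h. 0 < h \<Longrightarrow> h < d2 \<Longrightarrow> norm (integral {- s..- s + h} w' /\<^sub>R h - w' (- s)) < e"
      using N2(2)[OF \<open>- s \<notin> N2\<close> \<open>e > 0\<close>] by auto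
    have vw: "integral {c..d} w = integral {c..d} v" if "{c..d} \<subseteq> {a..b}" for c d
      using that by (intro integral_cong) (auto simp: w_def)
    have vs: "w s = v s"
      using s by (simp add: w_def)
    have vi: "v integrable_on {c..d}" if "{c..d} \<subseteq> {a..b}" for c d
      using integrable_subinterval_real[OF v that] .
    have bound: "norm (I - h *\<^sub>R v s) \<le> e * h" if "h > 0" "norm (I /\<^sub>R h - v s) < e" for h and I :: 'a
    proof -
      have "I - h *\<^sub>R v s = h *\<^sub>R (I /\<^sub>R h - v s)"
        using that by (simp add: algebra_simps)
      then show ?thesis
        using that by (simp add: mult.commute)
    qed
    show "\<exists>d>0. \<forall>y\<in>{a..b}. norm (y - s) < d \<longrightarrow>
        norm (integral {a..y} v - integral {a..s} v - (y - s) *\<^sub>R v s) \<le> e * norm (y - s)"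
    proof (intro exI[of _ "min d1 d2"] conjI ballI impI)
      fix y assume y: "y \<in> {a..b}" "norm (y - s) < min d1 d2"
      consider "y = s" | "y > s" | "y < s"
        by linarith
      then show "norm (integral {a..y} v - integral {a..s} v - (y - s) *\<^sub>R v s) \<le> e * norm (y - s)"
      proof cases
        case 2
        have "integral {a..s} v + integral {s..y} v = integral {a..y} v"
          using 2 s y vi by (intro Henstock_Kurzweil_Integration.integral_combine) auto
        then have "integral {a..y} v - integral {a..s} v = integral {s..y} v"
          by (simp add: algebra_simps)
        moreover have "norm (integral {s..y} v /\<^sub>R (y - s) - v s) < e"
          using d1(2)[of "y - s"] 2 y s vw[of s y] vs by simp
        ultimately show ?thesis
          using bound[of "y - s" "integral {s..y} v"] 2 by simp
      next
        case 3
        have "integral {a..y} v + integral {y..s} v = integral {a..s} v"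
          using 3 s y vi by (intro Henstock_Kurzweil_Integration.integral_combine) auto
        then have "integral {a..y} v - integral {a..s} v - (y - s) *\<^sub>R v s
            = - (integral {y..s} v - (s - y) *\<^sub>R v s)"
          by (simp add: algebra_simps)
        moreover have "norm (integral {y..s} v /\<^sub>R (s - y) - v s) < e"
        proof -
          have "integral {- s..- y} w' = integral {y..s} w"
            unfolding w'_def using Henstock_Kurzweil_Integration.integral_reflect_real[of "s" "y" w] by simp
          then show ?thesis
            using d2(2)[of "s - y"] 3 y s vw[of y s] vs by (simp add: w'_def)
        qed
        ultimately show ?thesis
          using bound[of "s - y" "integral {y..s} v"] 3 by (simp only: norm_minus_cancel) simp
      qed auto
    qed (use d1 d2 in auto)
  qed
  ultimately show ?thesis
    using that by blast
qed

section \<open>Successive approximations\<close>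

lemma AE_lebesgueE:
  fixes P :: "'a::euclidean_space \<Rightarrow> bool"
  assumes "AE x in lebesgue. P x"
  obtains N where "negligible N" "\<And>x. x \<notin> N \<Longrightarrow> P x"
proof -
  obtain N where N: "{x \<in> space lebesgue. \<not> P x} \<subseteq> N" "emeasure lebesgue N = 0" "N \<in> sets lebesgue"
    using AE_E[OF assms] by blast
  show thesis
    by (rule that[of N]) (use N in \<open>auto simp: negligible_iff_null_sets null_sets_def\<close>)
qed

lemma AE_lebesgueI:
  fixes P :: "'a::euclidean_space \<Rightarrow> bool"
  assumes "negligible N" "\<And>x. x \<notin> N \<Longrightarrow> P x"
  shows "AE x in lebesgue. P x"
  by (rule AE_I'[of N]) (use assms in \<open>auto simp: negligible_iff_null_sets\<close>)

lemma absolutely_continuous_on_nonincreasing: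
  fixes f :: "real \<Rightarrow> real"
  assumes "a \<le> b" "absolutely_continuous_on a b f" "negligible N"
    and f': "\<And>s. s \<in> {a..b} - N \<Longrightarrow> (f has_vector_derivative f' s) (at s within {a..b})"
    and nonpos: "\<And>s. s \<in> {a..b} - N \<Longrightarrow> f' s \<le> 0"
  shows "f b \<le> f a"
proof -
  have "(f' has_integral (f b - f a)) {a..b}"
    using absolutely_continuous_on_has_integral assms(1-4) by blast
  then have "((\<lambda>s. if s \<in> N then 0 else f' s) has_integral (f b - f a)) {a..b}"
    by (rule has_integral_spike[OF \<open>negligible N\<close>, rotated]) simp
  then have "f b - f a \<le> 0"
    by (rule has_integral_le[OF _ has_integral_0]) (use nonpos in auto)
  then show ?thesis
    by simp
qed

lemma absolutely_continuous_on_lipschitz: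
  fixes f :: "real \<Rightarrow> 'a::banach"
  assumes ac: "absolutely_continuous_on a b f" and N: "negligible N" and "M \<ge> 0"
    and f': "\<And>s. s \<in> {a..b} - N \<Longrightarrow> (f has_vector_derivative f' s) (at s within {a..b})"
    and bound: "\<And>s. s \<in> {a..b} - N \<Longrightarrow> norm (f' s) \<le> M"
  shows "M-lipschitz_on {a..b} f"
proof (rule lipschitz_onI)
  have *: "dist (f u) (f v) \<le> M * dist u v" if uv: "u \<in> {a..b}" "v \<in> {a..b}" "u \<le> v" for u v
  proof -
    have "(f' has_integral (f v - f u)) {u..v}"
    proof (rule absolutely_continuous_on_has_integral[OF uv(3) _ N])
      show "absolutely_continuous_on u v f"
        using absolutely_continuous_on_subinterval[OF ac] uv by simp
      show "(f has_vector_derivative f' s) (at s within {u..v})" if "s \<in> {u..v} - N" for s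
        by (rule has_vector_derivative_within_subset[OF f']) (use that uv in auto)
    qed
    then have "((\<lambda>s. if s \<in> N then 0 else f' s) has_integral (f v - f u)) (cbox u v)"
      unfolding box_real(2) by (rule has_integral_spike[OF N, rotated]) simp
    then have "norm (f v - f u) \<le> M * measure lborel (cbox u v)"
      by (rule has_integral_bound[OF \<open>M \<ge> 0\<close>]) (use bound uv \<open>M \<ge> 0\<close> in auto)
    then show ?thesis
      using uv by (simp add: dist_norm norm_minus_commute)
  qed
  show "dist (f u) (f v) \<le> M * dist u v" if "u \<in> {a..b}" "v \<in> {a..b}" for u v
    using *[of u v] *[of v u] that by (cases "u \<le> v") (auto simp: dist_commute)
qed (fact \<open>M \<ge> 0\<close>)

lemma integral_power_fact:
  assumes "a \<le> (s::real)"
  shows "((\<lambda>u. L * (C * (L * (u - a)) ^ k / fact k)) has_integral (C * (L * (s - a)) ^ Suc k / fact (Suc k))) {a..s}"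
proof -
  have "((\<lambda>u. L * (C * (L * (u - a)) ^ k / fact k)) has_integral
      (C * (L * (s - a)) ^ Suc k / fact (Suc k) - C * (L * (a - a)) ^ Suc k / fact (Suc k))) {a..s}"
  proof (rule fundamental_theorem_of_calculus[OF assms])
    fix x
    have "((\<lambda>u. C * (L * (u - a)) ^ n / fact n) has_real_derivative
        C * (of_nat n * (L * (x - a)) ^ (n - 1) * L) / fact n) (at x within {a..s})" for n
      by (auto intro!: derivative_eq_intros)
    from this[of "Suc k"]
    have "((\<lambda>u. C * (L * (u - a)) ^ Suc k / fact (Suc k)) has_real_derivative
        C * (of_nat (Suc k) * (L * (x - a)) ^ k * L) / fact (Suc k)) (at x within {a..s})"
      by simp
    also have "C * (of_nat (Suc k) * (L * (x - a)) ^ k * L) / fact (Suc k)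
        = L * (C * (L * (x - a)) ^ k / fact k)"
      by (simp add: field_simps del: of_nat_Suc)
    finally show "((\<lambda>u. C * (L * (u - a)) ^ Suc k / fact (Suc k)) has_vector_derivative
        L * (C * (L * (x - a)) ^ k / fact k)) (at x within {a..s})"
      by (simp add: has_real_derivative_iff_has_vector_derivative)
  qed
  then show ?thesis
    by simp
qed

lemma sum_power_fact_le_exp:
  fixes x :: real
  assumes "x \<ge> 0"
  shows "(\<Sum>j<k. x ^ j / fact j) \<le> exp x"
proof -
  have "(\<lambda>j. x ^ j /\<^sub>R fact j) sums exp x"
    by (rule exp_converges)
  then have "(\<lambda>j. x ^ j / fact j) sums exp x"
    by (simp add: field_simps)
  then show ?thesis
    using assms sum_le_suminf[of "\<lambda>j. x ^ j / fact j" "{..<k}"] by (simp add: sums_iff)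
qed

text \<open>The velocities are updated by \<open>v\<^sub>k\<^sub>+\<^sub>1(s) = G s (y\<^sub>k(s)) (v\<^sub>k(s))\<close>, where \<open>y\<^sub>k\<close> is the curve
  with velocity \<open>v\<^sub>k\<close>: since \<open>v\<^sub>k(s)\<close> lies in \<open>S s (y\<^sub>k\<^sub>-\<^sub>1(s))\<close>, the change is at most
  \<open>L \<bar>y\<^sub>k - y\<^sub>k\<^sub>-\<^sub>1\<bar>\<close>.\<close>

proposition filippov:
  fixes G :: "real \<Rightarrow> 'a::euclidean_space \<Rightarrow> 'a \<Rightarrow> 'a" and S :: "real \<Rightarrow> 'a \<Rightarrow> 'a set"
    and xbar v0 :: "real \<Rightarrow> 'a"
  assumes "L \<ge> 0"
    and contG: "continuous_on ({a..b} \<times> K \<times> W) (\<lambda>(s, x, v). G s x v)"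
    and GS: "\<And>s x v. s \<in> {a..b} \<Longrightarrow> x \<in> K \<Longrightarrow> v \<in> W \<Longrightarrow> G s x v \<in> S s x"
    and SW: "\<And>s x. s \<in> {a..b} \<Longrightarrow> x \<in> K \<Longrightarrow> S s x \<subseteq> W"
    and clS: "\<And>s x. s \<in> {a..b} \<Longrightarrow> x \<in> K \<Longrightarrow> closed (S s x)"
    and W: "bounded W"
    and lipG: "\<And>s x y v. s \<in> {a..b} \<Longrightarrow> x \<in> K \<Longrightarrow> y \<in> K \<Longrightarrow> v \<in> S s x \<Longrightarrow>
      norm (G s y v - v) \<le> L * norm (x - y)"
    and tube: "\<And>s. s \<in> {a..b} \<Longrightarrow> cball (xbar s) r \<subseteq> K"
    and h: "norm h * exp (L * (b - a)) \<le> r"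
    and v0: "\<And>s. s \<in> {a..b} \<Longrightarrow> v0 s \<in> S s (xbar s)"
    and xbar: "\<And>s. s \<in> {a..b} \<Longrightarrow> (v0 has_integral (xbar s - xbar a)) {a..s}"
  obtains y v where "\<And>s. s \<in> {a..b} \<Longrightarrow> v s \<in> S s (y s)"
    "\<And>s. s \<in> {a..b} \<Longrightarrow> (v has_integral (y s - (xbar a + h))) {a..s}"
    "\<And>s. s \<in> {a..b} \<Longrightarrow> norm (y s - xbar s) \<le> norm h * exp (L * (s - a))"
proof (cases "a \<le> b")
  case False
  then show ?thesis
    using that by simp
next
  case ab: True
  obtain B where B: "\<And>v. v \<in> W \<Longrightarrow> norm v \<le> B"
    using W by (auto simp: bounded_iff)
  have r: "r \<ge> 0"
    using h by (meson dual_order.trans exp_ge_zero mult_nonneg_nonneg norm_ge_zero)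
  have xbarK: "xbar s \<in> K" if "s \<in> {a..b}" for s
    using tube[OF that] r by (meson centre_in_cball subsetD)
  define Y where "Y v s = xbar a + h + integral {a..s} v" for v and s :: real
  define V where "V = rec_nat v0 (\<lambda>k v s. G s (Y v s) (v s))"
  have V0: "V 0 = v0" and VSuc: "V (Suc k) = (\<lambda>s. G s (Y (V k) s) (V k s))" for k
    by (simp_all add: V_def)
  define Z where "Z k = (case k of 0 \<Rightarrow> xbar | Suc j \<Rightarrow> Y (V j))" for k
  have Z0: "Z 0 = xbar" and ZSuc: "Z (Suc k) = Y (V k)" for k
    by (simp_all add: Z_def)
  define C where "C = norm h"
  define \<theta> where "\<theta> k s = C * (L * (s - a)) ^ k / fact k" for k and s :: real
  have "C \<ge> 0"
    by (simp add: C_def)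
  have \<theta>_nonneg: "\<theta> k s \<ge> 0" if "s \<in> {a..b}" for k s
    using that \<open>L \<ge> 0\<close> \<open>C \<ge> 0\<close> by (simp add: \<theta>_def)
  have \<theta>_sum: "(\<Sum>j<k. \<theta> j s) \<le> C * exp (L * (s - a))" if "s \<in> {a..b}" for k s
  proof -
    have "(\<Sum>j<k. \<theta> j s) = C * (\<Sum>j<k. (L * (s - a)) ^ j / fact j)"
      by (simp add: \<theta>_def sum_distrib_left)
    also have "\<dots> \<le> C * exp (L * (s - a))"
      using that \<open>L \<ge> 0\<close> \<open>C \<ge> 0\<close> by (intro mult_left_mono sum_power_fact_le_exp) auto
    finally show ?thesis .
  qed
  have exp_r: "C * exp (L * (s - a)) \<le> r" if "s \<in> {a..b}" for s
  proof -
    have "C * exp (L * (s - a)) \<le> C * exp (L * (b - a))"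
      using that \<open>L \<ge> 0\<close> \<open>C \<ge> 0\<close> by (intro mult_left_mono) (auto intro: mult_left_mono)
    then show ?thesis
      using h by (simp add: C_def)
  qed
  define good where "good k \<longleftrightarrow> V k integrable_on {a..b} \<and>
    (\<forall>s\<in>{a..b}. V k s \<in> S s (Z k s) \<and> Z k s \<in> K \<and> norm (Z (Suc k) s - Z k s) \<le> \<theta> k s)" for k
  have tubeK: "Z k s \<in> K" if s: "s \<in> {a..b}" and "\<forall>j<k. norm (Z (Suc j) s - Z j s) \<le> \<theta> j s" for k s
  proof -
    have "norm (Z k s - xbar s) = norm (\<Sum>j<k. Z (Suc j) s - Z j s)"
      by (simp add: sum_lessThan_telescope[of "\<lambda>j. Z j s"] Z0)
    also have "\<dots> \<le> (\<Sum>j<k. \<theta> j s)"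
      using that by (intro sum_norm_le) auto
    also have "\<dots> \<le> r"
      using \<theta>_sum[OF s] exp_r[OF s] by (rule order_trans)
    finally show ?thesis
      using tube[OF s] by (auto simp: dist_norm norm_minus_commute)
  qed
  have vi: "v integrable_on {a..s}" if "v integrable_on {a..b}" "s \<in> {a..b}" for v :: "real \<Rightarrow> 'a" and s
    using integrable_subinterval_real[OF that(1)] that(2) by simp
  have contY: "continuous_on {a..b} (Y v)" if "v integrable_on {a..b}" for v
    unfolding Y_def using indefinite_integral_continuous_1[OF that] by (intro continuous_intros)
  have good: "good k" for k
  proof (induction k rule: less_induct)
    case (less k)
    show ?case
    proof (cases k)
      case 0
      have "V 0 integrable_on {a..b}"
        using xbar[of b] ab by (auto simp: V0)
      moreover have "Y v0 s - xbar s = h" if "s \<in> {a..b}" for s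
        using xbar[OF that] by (simp add: Y_def integral_unique)
      ultimately show ?thesis
        using v0 xbarK by (auto simp: good_def 0 V0 Z0 ZSuc[of 0, simplified] \<theta>_def C_def)
    next
      case (Suc j)
      have gj: "good j"
        using less Suc by simp
      have Vj: "V j integrable_on {a..b}"
        using gj by (simp add: good_def)
      have ZK: "Z k s \<in> K" if "s \<in> {a..b}" for s
        using that less by (intro tubeK) (auto simp: good_def)
      have VjW: "V j s \<in> W" if "s \<in> {a..b}" for s
        using gj SW that unfolding good_def by blast
      have VkS: "V k s \<in> S s (Z k s)" if "s \<in> {a..b}" for s
        using GS[OF that ZK[OF that] VjW[OF that]] by (simp add: Suc VSuc ZSuc)
      have VkW: "V k s \<in> W" if "s \<in> {a..b}" for s
        using VkS SW ZK that by blast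
      have meas: "V k \<in> borel_measurable (lebesgue_on {a..b})"
      proof -
        have "V j \<in> borel_measurable (lebesgue_on {a..b})"
          using Vj by (rule integrable_imp_measurable)
        moreover have "Y (V j) \<in> borel_measurable (lebesgue_on {a..b})"
          using contY[OF Vj] by (intro continuous_imp_measurable_on_sets_lebesgue) auto
        moreover have "(\<lambda>s. s) \<in> borel_measurable (lebesgue_on {a..b})"
          by (intro continuous_imp_measurable_on_sets_lebesgue) auto
        ultimately have "(\<lambda>s. (s, Y (V j) s, V j s)) \<in> borel_measurable (lebesgue_on {a..b})"
          by (intro borel_measurable_Pair)
        then have "(\<lambda>s. (s, Y (V j) s, V j s)) \<in> lebesgue_on {a..b} \<rightarrow>\<^sub>M restrict_space borel ({a..b} \<times> K \<times> W)"
          by (rule measurable_restrict_space2[rotated]) (use ZK VjW in \<open>auto simp: Suc ZSuc\<close>)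
        from measurable_comp[OF this borel_measurable_continuous_on_restrict[OF contG]]
        show ?thesis
          by (simp add: Suc VSuc comp_def)
      qed
      have Vk: "V k integrable_on {a..b}"
      proof (rule measurable_bounded_by_integrable_imp_integrable[OF meas])
        show "(\<lambda>s. B) integrable_on {a..b}"
          by (rule integrable_const_ivl)
      qed (use VkW B in auto)
      have diff: "norm (Z (Suc k) s - Z k s) \<le> \<theta> k s" if s: "s \<in> {a..b}" for s
      proof -
        have "Z (Suc k) s - Z k s = integral {a..s} (V k) - integral {a..s} (V j)"
          by (simp add: ZSuc Suc Y_def)
        also have "\<dots> = integral {a..s} (\<lambda>u. V k u - V j u)"
          using vi[OF Vk s] vi[OF Vj s] by (simp add: Henstock_Kurzweil_Integration.integral_diff)
        also have "norm \<dots> \<le> integral {a..s} (\<lambda>u. L * \<theta> j u)"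
        proof (rule Henstock_Kurzweil_Integration.integral_norm_bound_integral)
          show "(\<lambda>u. V k u - V j u) integrable_on {a..s}"
            using vi[OF Vk s] vi[OF Vj s] by (rule integrable_diff)
          show "(\<lambda>u. L * \<theta> j u) integrable_on {a..s}"
            using integral_power_fact[of a s L C j] s unfolding \<theta>_def by auto
          fix u assume "u \<in> {a..s}"
          then have u: "u \<in> {a..b}"
            using s by auto
          have "norm (V k u - V j u) = norm (G u (Z k u) (V j u) - V j u)"
            by (simp add: Suc VSuc ZSuc)
          also have "\<dots> \<le> L * norm (Z j u - Z k u)"
            using gj u ZK[OF u] by (intro lipG) (auto simp: good_def)
          also have "\<dots> \<le> L * \<theta> j u"
            using gj u \<open>L \<ge> 0\<close> by (intro mult_left_mono) (auto simp: good_def Suc norm_minus_commute)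
          finally show "norm (V k u - V j u) \<le> L * \<theta> j u" .
        qed
        also have "\<dots> = \<theta> k s"
          using integral_unique[OF integral_power_fact[of a s L C j]] s unfolding \<theta>_def Suc by (simp del: power_Suc fact_Suc)
        finally show ?thesis .
      qed
      show ?thesis
        using Vk VkS ZK diff by (simp add: good_def)
    qed
  qed
  have Vi: "V k integrable_on {a..b}" for k
    using good by (simp add: good_def)
  have ZK: "Z k s \<in> K" and VS: "V k s \<in> S s (Z k s)" and Zdiff: "norm (Z (Suc k) s - Z k s) \<le> \<theta> k s"
    if "s \<in> {a..b}" for k s
    using good that by (auto simp: good_def)
  have VW: "V k s \<in> W" if "s \<in> {a..b}" for k s
    using VS ZK SW that by blast
  have Vdiff: "norm (V (Suc k) s - V k s) \<le> L * \<theta> k s" if s: "s \<in> {a..b}" for k s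
  proof -
    have "norm (V (Suc k) s - V k s) = norm (G s (Z (Suc k) s) (V k s) - V k s)"
      by (simp add: VSuc ZSuc)
    also have "\<dots> \<le> L * norm (Z k s - Z (Suc k) s)"
      using s ZK VS by (intro lipG) auto
    also have "\<dots> \<le> L * \<theta> k s"
      using Zdiff[OF s] \<open>L \<ge> 0\<close> by (intro mult_left_mono) (auto simp: norm_minus_commute)
    finally show ?thesis .
  qed
  have \<theta>_summable: "summable (\<lambda>k. \<theta> k s)" for s
  proof -
    have "summable (\<lambda>k. (L * (s - a)) ^ k /\<^sub>R fact k)"
      using exp_converges sums_summable by blast
    from summable_mult[OF this, of C] show ?thesis
      by (simp add: \<theta>_def field_simps)
  qed
  have "convergent (\<lambda>k. V k s)" if s: "s \<in> {a..b}" for s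
  proof -
    have "summable (\<lambda>k. V (Suc k) s - V k s)"
      by (rule summable_comparison_test'[OF summable_mult[OF \<theta>_summable[of s], of L], of 0])
        (use Vdiff[OF s] in auto)
    then have "convergent (\<lambda>n. \<Sum>k<n. V (Suc k) s - V k s)"
      by (simp add: summable_iff_convergent)
    then have "convergent (\<lambda>n. V n s - V 0 s)"
      by (simp add: sum_lessThan_telescope[of "\<lambda>k. V k s"])
    then show ?thesis
      by (simp add: convergent_diff_const_right_iff)
  qed
  then obtain v where v: "\<And>s. s \<in> {a..b} \<Longrightarrow> (\<lambda>k. V k s) \<longlonglongrightarrow> v s"
    unfolding convergent_def by metis
  define y where "y = Y v"
  have dom: "v integrable_on {a..s}" "(\<lambda>k. integral {a..s} (V k)) \<longlonglongrightarrow> integral {a..s} v"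
    if s: "s \<in> {a..b}" for s
  proof -
    have 1: "V k integrable_on {a..s}" for k
      using vi[OF Vi s] .
    have 2: "(\<lambda>s. B) integrable_on {a..s}"
      by (rule integrable_const_ivl)
    have 3: "norm (V k u) \<le> B" if "u \<in> {a..s}" for k u
      using B VW that s by auto
    have 4: "(\<lambda>k. V k u) \<longlonglongrightarrow> v u" if "u \<in> {a..s}" for u
      using v that s by auto
    show "v integrable_on {a..s}" "(\<lambda>k. integral {a..s} (V k)) \<longlonglongrightarrow> integral {a..s} v"
      using dominated_convergence[OF 1 2 3 4] by auto
  qed
  have Zlim: "(\<lambda>k. Z k s) \<longlonglongrightarrow> y s" if "s \<in> {a..b}" for s
  proof -
    have "(\<lambda>k. Z (Suc k) s) \<longlonglongrightarrow> y s"
      unfolding ZSuc Y_def y_def using dom(2)[OF that] by (intro tendsto_intros)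
    then show ?thesis
      by (rule LIMSEQ_imp_Suc)
  qed
  have ybound: "norm (y s - xbar s) \<le> norm h * exp (L * (s - a))" if s: "s \<in> {a..b}" for s
  proof (rule LIMSEQ_le_const2)
    show "(\<lambda>k. norm (Z k s - xbar s)) \<longlonglongrightarrow> norm (y s - xbar s)"
      using Zlim[OF s] by (intro tendsto_intros)
    have "norm (Z k s - xbar s) \<le> C * exp (L * (s - a))" for k
    proof -
      have "norm (Z k s - xbar s) = norm (\<Sum>j<k. Z (Suc j) s - Z j s)"
        by (simp add: sum_lessThan_telescope[of "\<lambda>j. Z j s"] Z0)
      also have "\<dots> \<le> (\<Sum>j<k. \<theta> j s)"
        using Zdiff[OF s] by (intro sum_norm_le) auto
      finally show ?thesis
        using \<theta>_sum[OF s] by (rule order_trans)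
    qed
    then show "\<exists>n. \<forall>k\<ge>n. norm (Z k s - xbar s) \<le> norm h * exp (L * (s - a))"
      by (simp add: C_def)
  qed
  have yK: "y s \<in> K" if s: "s \<in> {a..b}" for s
  proof -
    have "norm (y s - xbar s) \<le> r"
      using ybound[OF s] exp_r[OF s] by (simp add: C_def)
    then show ?thesis
      using tube[OF s] by (auto simp: dist_norm norm_minus_commute)
  qed
  show ?thesis
  proof (rule that[of v y])
    fix s assume s: "s \<in> {a..b}"
    show "(v has_integral (y s - (xbar a + h))) {a..s}"
      using dom(1)[OF s] by (simp add: y_def Y_def has_integral_iff)
    show "norm (y s - xbar s) \<le> norm h * exp (L * (s - a))"
      by (rule ybound[OF s])
    have "(\<lambda>k. G s (y s) (V k s) - V k s) \<longlonglongrightarrow> 0"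
    proof (rule Lim_null_comparison)
      show "\<forall>\<^sub>F k in sequentially. norm (G s (y s) (V k s) - V k s) \<le> L * norm (Z k s - y s)"
        using s ZK VS yK by (intro always_eventually allI lipG) auto
      have "(\<lambda>k. Z k s - y s) \<longlonglongrightarrow> 0"
        using Zlim[OF s] by (rule LIM_zero)
      then show "(\<lambda>k. L * norm (Z k s - y s)) \<longlonglongrightarrow> 0"
        by (intro tendsto_mult_right_zero tendsto_norm_zero)
    qed
    from tendsto_add[OF this v[OF s]] have "(\<lambda>k. G s (y s) (V k s)) \<longlonglongrightarrow> v s"
      by simp
    then show "v s \<in> S s (y s)"
      by (rule Lim_in_closed_set[OF clS[OF s yK[OF s]], rotated 2]) (use GS s yK VW in auto)
  qed
qed

section \<open>The Hamiltonian\<close>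

lemma continuous_on_pointwise_lipschitz:
  fixes f :: "'a::metric_space \<Rightarrow> real"
  assumes "\<And>z. z \<in> S \<Longrightarrow> \<exists>M. \<forall>w\<in>S. \<bar>f w - f z\<bar> \<le> M * dist w z"
  shows "continuous_on S f"
  unfolding continuous_on_iff
proof (intro ballI allI impI)
  fix z e assume "z \<in> S" "(e::real) > 0"
  then obtain M where M: "\<And>w. w \<in> S \<Longrightarrow> \<bar>f w - f z\<bar> \<le> M * dist w z"
    using assms by blast
  show "\<exists>d>0. \<forall>w\<in>S. dist w z < d \<longrightarrow> dist (f w) (f z) < e"
  proof (intro exI[of _ "e / (\<bar>M\<bar> + 1)"] conjI ballI impI)
    fix w assume w: "w \<in> S" "dist w z < e / (\<bar>M\<bar> + 1)"
    have "\<bar>f w - f z\<bar> \<le> (\<bar>M\<bar> + 1) * dist w z"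
      by (rule order_trans[OF M[OF w(1)]]) (intro mult_right_mono, auto)
    also have "\<dots> < e"
      using w(2) by (simp add: field_simps)
    finally show "dist (f w) (f z) < e"
      by (simp add: dist_real_def)
  qed (use \<open>e > 0\<close> in simp)
qed

lemma hamiltonian_upper:
  assumes "compact (F x)" "v \<in> F x"
  shows "v \<bullet> p \<le> hamiltonian F x p"
  unfolding hamiltonian_def
proof (rule cSUP_upper[OF assms(2)])
  have "compact ((\<lambda>v. v \<bullet> p) ` F x)"
    using assms(1) by (intro compact_continuous_image continuous_intros)
  then show "bdd_above ((\<lambda>v. v \<bullet> p) ` F x)"
    by (rule bounded_imp_bdd_above[OF compact_imp_bounded])
qed

lemma hamiltonian_attained:
  assumes "compact (F x)" "F x \<noteq> {}"
  obtains v where "v \<in> F x" "v \<bullet> p = hamiltonian F x p"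
proof -
  have "continuous_on (F x) (\<lambda>v. v \<bullet> p)"
    by (intro continuous_intros)
  then obtain v where v: "v \<in> F x" "\<forall>w\<in>F x. w \<bullet> p \<le> v \<bullet> p"
    using continuous_attains_sup[OF assms] by blast
  then have "hamiltonian F x p = v \<bullet> p"
    unfolding hamiltonian_def by (intro cSup_eq_maximum) auto
  then show ?thesis
    using that v by simp
qed

lemma hamiltonian_le:
  assumes "F x \<noteq> {}" "\<And>v. v \<in> F x \<Longrightarrow> v \<bullet> p \<le> M"
  shows "hamiltonian F x p \<le> M"
  unfolding hamiltonian_def using assms by (intro cSUP_least)

lemma hamiltonian_lipschitz_momentum:
  assumes "compact (F x)" "F x \<noteq> {}" "\<And>v. v \<in> F x \<Longrightarrow> norm v \<le> R"
  shows "hamiltonian F x p \<le> hamiltonian F x q + R * norm (p - q)"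
proof (rule hamiltonian_le[of F x, OF assms(2)])
  fix v assume v: "v \<in> F x"
  have "v \<bullet> p = v \<bullet> q + v \<bullet> (p - q)"
    by (simp add: inner_diff_right)
  also have "v \<bullet> (p - q) \<le> norm v * norm (p - q)"
    by (rule norm_cauchy_schwarz)
  also have "\<dots> \<le> R * norm (p - q)"
    using assms(3)[OF v] by (intro mult_right_mono) auto
  finally show "v \<bullet> p \<le> hamiltonian F x q + R * norm (p - q)"
    using hamiltonian_upper[of F x v q, OF assms(1) v] by simp
qed

lemma infdist_le_hausdorff_distance:
  fixes A B :: "'a::heine_borel set"
  assumes "compact A" "A \<noteq> {}" "compact B" "B \<noteq> {}"
  shows "infdist v B \<le> infdist v A + hausdorff_distance A B"
proof -
  obtain a where a: "a \<in> A" "infdist v A = dist v a"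
    using infdist_attains_inf[OF compact_imp_closed[OF assms(1)] assms(2)] by blast
  have "compact ((\<lambda>a. infdist a B) ` A)"
    using assms(1) by (intro compact_continuous_image continuous_intros)
  then have "bdd_above ((\<lambda>a. infdist a B) ` A)"
    by (rule bounded_imp_bdd_above[OF compact_imp_bounded])
  then have "infdist a B \<le> hausdorff_distance A B"
    using cSUP_upper[OF a(1), of "\<lambda>a. infdist a B"] by (simp add: hausdorff_distance_def)
  then show ?thesis
    using infdist_triangle[of v B a] a(2) by simp
qed

lemma locally_lipschitz_multifunction_infdist:
  fixes F :: "'a::euclidean_space \<Rightarrow> 'b::euclidean_space set"
  assumes F: "\<And>x. compact (F x)" "\<And>x. F x \<noteq> {}"
    and lip: "locally_lipschitz_multifunction F" and K: "compact K"
  obtains L where "L \<ge> 0"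
    "\<And>v x y. norm v \<le> R \<Longrightarrow> x \<in> K \<Longrightarrow> y \<in> K \<Longrightarrow> infdist v (F y) \<le> infdist v (F x) + L * norm (x - y)"
proof -
  have "local_lipschitz (cball 0 R) K (\<lambda>v x. infdist v (F x))"
    unfolding local_lipschitz_def
  proof (intro ballI)
    fix x and v :: 'b assume "x \<in> K"
    obtain u L where u: "u > 0" "L \<ge> 0"
      "\<And>y z. y \<in> cball x u \<Longrightarrow> z \<in> cball x u \<Longrightarrow> hausdorff_distance (F y) (F z) \<le> L * dist y z"
      using lip unfolding locally_lipschitz_multifunction_def by meson
    have *: "infdist w (F z) \<le> infdist w (F y) + L * dist y z" if "y \<in> cball x u" "z \<in> cball x u" for w y z
      using u(3)[OF that] infdist_le_hausdorff_distance[OF F F, of w z y] by simp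
    have "L-lipschitz_on (cball x u \<inter> K) (\<lambda>x. infdist w (F x))" for w
    proof (rule lipschitz_onI)
      fix y z assume "y \<in> cball x u \<inter> K" "z \<in> cball x u \<inter> K"
      then show "dist (infdist w (F y)) (infdist w (F z)) \<le> L * dist y z"
        using *[of y z w] *[of z y w] by (auto simp: dist_real_def dist_commute abs_le_iff)
    qed (fact u(2))
    then show "\<exists>u>0. \<exists>L. \<forall>w\<in>cball v u \<inter> cball 0 R. L-lipschitz_on (cball x u \<inter> K) (\<lambda>x. infdist w (F x))"
      using u(1) by blast
  qed
  then obtain L where "\<forall>v\<in>cball 0 R. L-lipschitz_on K (\<lambda>x. infdist v (F x))"
    by (rule local_lipschitz_compact_implies_lipschitz[OF _ K compact_cball])
       (intro continuous_on_infdist continuous_on_id, blast)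
  then have L: "L-lipschitz_on K (\<lambda>x. infdist v (F x))" if "v \<in> cball 0 R" for v :: 'b
    using that by blast
  show ?thesis
  proof (rule that[of "max L 0"])
    fix v :: 'b and x y assume "norm v \<le> R" "x \<in> K" "y \<in> K"
    then have "dist (infdist v (F y)) (infdist v (F x)) \<le> L * dist y x"
      using lipschitz_onD[OF L, of v y x] by simp
    also have "\<dots> \<le> max L 0 * norm (x - y)"
      by (simp add: dist_norm norm_minus_commute mult_right_mono)
    finally show "infdist v (F y) \<le> infdist v (F x) + max L 0 * norm (x - y)"
      by (simp add: dist_real_def)
  qed simp
qed

lemma clarke_gradient_hamiltonian:
  fixes F :: "'a::real_inner \<Rightarrow> 'a set"
  assumes F: "compact (F x)" "F x \<noteq> {}" and v: "v \<in> clarke_gradient (hamiltonian F x) p"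
  shows "hamiltonian F x p \<le> v \<bullet> p"
proof (rule field_le_epsilon)
  fix e :: real assume "e > 0"
  let ?H = "hamiltonian F x"
  obtain R where R: "R > 0" "\<And>w. w \<in> F x \<Longrightarrow> norm w \<le> R"
    using compact_imp_bounded[OF F(1)] by (auto simp: bounded_pos)
  have quot: "(?H (y + h *\<^sub>R - p) - ?H y) / h \<le> - ?H p + 2 * R * norm (y - p)" if "0 < h" "h < 1" for y h
  proof -
    have "?H (y + h *\<^sub>R - p) \<le> (1 - h) * ?H y + h * ?H (y - p)"
    proof (rule hamiltonian_le[of F x, OF F(2)])
      fix w assume w: "w \<in> F x"
      have "w \<bullet> (y + h *\<^sub>R - p) = (1 - h) * (w \<bullet> y) + h * (w \<bullet> (y - p))"
        by (simp add: inner_add_right inner_diff_right algebra_simps)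
      also have "\<dots> \<le> (1 - h) * ?H y + h * ?H (y - p)"
        using that hamiltonian_upper[of F x w, OF F(1) w] by (intro add_mono mult_left_mono) auto
      finally show "w \<bullet> (y + h *\<^sub>R - p) \<le> (1 - h) * ?H y + h * ?H (y - p)" .
    qed
    also have "\<dots> = ?H y + h * (?H (y - p) - ?H y)"
      by (simp add: algebra_simps)
    finally have "(?H (y + h *\<^sub>R - p) - ?H y) / h \<le> ?H (y - p) - ?H y"
      using that by (simp add: divide_simps mult.commute)
    moreover have "?H (y - p) \<le> ?H 0 + R * norm (y - p)"
      using hamiltonian_lipschitz_momentum[of F x R "y - p" 0] F R by simp
    moreover have "?H 0 \<le> 0"
      by (rule hamiltonian_le[of F x, OF F(2)]) simp
    moreover have "?H p \<le> ?H y + R * norm (y - p)"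
      using hamiltonian_lipschitz_momentum[of F x R p y] F R by (simp add: norm_minus_commute)
    ultimately show ?thesis
      by simp
  qed
  have "eventually (\<lambda>y. y \<in> ball p (e / (2 * R))) (nhds p)"
    using \<open>e > 0\<close> \<open>R > 0\<close> by (intro eventually_nhds_in_open) auto
  moreover have "eventually (\<lambda>h::real. h \<in> {0<..<1}) (at_right 0)"
    by (rule eventually_at_right_real) simp
  ultimately have "eventually (\<lambda>z. fst z \<in> ball p (e / (2 * R)) \<and> snd z \<in> {0<..<1})
      (nhds p \<times>\<^sub>F at_right (0::real))"
    by (auto simp: eventually_prod_filter)
  then have "eventually (\<lambda>z. (case z of (y, h) \<Rightarrow> ereal ((?H (y + h *\<^sub>R - p) - ?H y) / h)) \<le> ereal (- ?H p + e))
      (nhds p \<times>\<^sub>F at_right 0)"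
  proof (rule eventually_mono)
    fix z :: "'a \<times> real" assume z: "fst z \<in> ball p (e / (2 * R)) \<and> snd z \<in> {0<..<1}"
    obtain y h where yh: "z = (y, h)"
      by fastforce
    have "2 * R * norm (y - p) \<le> e"
      using z yh \<open>R > 0\<close> by (simp add: dist_norm norm_minus_commute field_simps)
    then show "(case z of (y, h) \<Rightarrow> ereal ((?H (y + h *\<^sub>R - p) - ?H y) / h)) \<le> ereal (- ?H p + e)"
      using quot[of h y] z yh by simp
  qed
  then have "clarke_derivative ?H p (- p) \<le> ereal (- ?H p + e)"
    unfolding clarke_derivative_def by (rule Limsup_bounded)
  then have "ereal (v \<bullet> - p) \<le> ereal (- ?H p + e)"
    using v unfolding clarke_gradient_def by (blast intro: order_trans)
  then show "?H p \<le> v \<bullet> p + e"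
    by simp
qed

text \<open>Iterating the midpoint inequality between \<open>x\<close> and \<open>x + d / 2\<^sup>k\<close> turns the first-order
  information at \<open>x\<close> into a quadratic lower bound on all of \<open>K\<close>.\<close>

lemma semiconvex_on_frechet_subdifferential:
  fixes u :: "'a::real_inner \<Rightarrow> real"
  assumes sc: "semiconvex_on K C u" and "C \<ge> 0" and K: "convex K" "x \<in> K" "y \<in> K"
    and q: "q \<in> frechet_subdifferential u x"
  shows "u y - u x \<ge> q \<bullet> (y - x) - C / 2 * (norm (y - x))\<^sup>2"
proof (cases "y = x")
  case False
  define d where "d = y - x"
  have "d \<noteq> 0"
    using False by (simp add: d_def)
  define z where "z k = x + (1 / 2 ^ k) *\<^sub>R d" for k :: nat
  have z0: "z 0 = y"
    by (simp add: z_def d_def)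
  have zK: "z k \<in> K" for k
  proof -
    have "z k = (1 - 1 / 2 ^ k) *\<^sub>R x + (1 / 2 ^ k) *\<^sub>R y"
      by (simp add: z_def d_def algebra_simps)
    also have "\<dots> \<in> K"
      by (rule convexD[OF K(1) K(2,3)]) auto
    finally show ?thesis .
  qed
  have step: "u (z k) - u x \<ge> 2 * (u (z (Suc k)) - u x) - C * (norm d)\<^sup>2 / 4 / (2 ^ k)\<^sup>2" for k
  proof -
    define h where "h = (1 / 2 ^ Suc k) *\<^sub>R d"
    have h: "z (Suc k) + h = z k" "z (Suc k) - h = x"
      by (simp_all add: z_def h_def flip: scaleR_add_left)
    have "closed_segment x (z k) \<subseteq> K"
      using K(1,2) zK by (simp add: closed_segment_subset)
    then have "u (z k) + u x - 2 * u (z (Suc k)) \<ge> - C * (norm h)\<^sup>2"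
      using sc h unfolding semiconvex_on_def by metis
    moreover have "(norm h)\<^sup>2 = (norm d)\<^sup>2 / 4 / (2 ^ k)\<^sup>2"
      by (simp add: h_def power_mult_distrib power_divide)
    ultimately show ?thesis
      by (simp add: algebra_simps)
  qed
  have iter: "u (z 0) - u x \<ge> 2 ^ k * (u (z k) - u x) - C * (norm d)\<^sup>2 / 2 * (1 - 1 / 2 ^ k)" for k
  proof (induction k)
    case (Suc k)
    have "2 ^ k * (u (z k) - u x) \<ge> 2 ^ k * (2 * (u (z (Suc k)) - u x) - C * (norm d)\<^sup>2 / 4 / (2 ^ k)\<^sup>2)"
      by (intro mult_left_mono step) simp
    also have "2 ^ k * (2 * (u (z (Suc k)) - u x) - C * (norm d)\<^sup>2 / 4 / (2 ^ k)\<^sup>2)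
        = 2 ^ Suc k * (u (z (Suc k)) - u x) - C * (norm d)\<^sup>2 / 2 * (1 / 2 ^ k - 1 / 2 ^ Suc k)"
      by (simp add: field_simps power2_eq_square)
    finally have "2 ^ Suc k * (u (z (Suc k)) - u x) - C * (norm d)\<^sup>2 / 2 * (1 / 2 ^ k - 1 / 2 ^ Suc k)
        - C * (norm d)\<^sup>2 / 2 * (1 - 1 / 2 ^ k) \<le> u (z 0) - u x"
      using Suc by linarith
    moreover have "C * (norm d)\<^sup>2 / 2 * (1 / 2 ^ k - 1 / 2 ^ Suc k) + C * (norm d)\<^sup>2 / 2 * (1 - 1 / 2 ^ k)
        = C * (norm d)\<^sup>2 / 2 * (1 - 1 / 2 ^ Suc k)"
      by (simp only: distrib_left[symmetric]) simp
    ultimately show ?case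
      by linarith
  qed simp
  have "q \<bullet> d \<le> (u y - u x + C / 2 * (norm d)\<^sup>2)"
  proof (rule field_le_epsilon)
    fix e :: real assume "e > 0"
    define \<eta> where "\<eta> = e / norm d"
    have "\<eta> > 0"
      using \<open>e > 0\<close> \<open>d \<noteq> 0\<close> by (simp add: \<eta>_def)
    have "\<forall>c<0. eventually (\<lambda>y. c < ereal ((u y - u x - q \<bullet> (y - x)) / norm (y - x))) (at x)"
      using q unfolding frechet_subdifferential_def le_Liminf_iff by simp
    then have "eventually (\<lambda>y. ereal (- \<eta>) < ereal ((u y - u x - q \<bullet> (y - x)) / norm (y - x))) (at x)"
      by (rule allE[of _ "ereal (- \<eta>)"]) (use \<open>\<eta> > 0\<close> in simp)
    moreover have "filterlim z (at x) sequentially"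
    proof (rule filterlim_atI)
      have "(\<lambda>k. (1 / 2) ^ k *\<^sub>R d) \<longlonglongrightarrow> 0 *\<^sub>R d"
        by (intro tendsto_scaleR LIMSEQ_power_zero tendsto_const) simp
      from tendsto_add[OF tendsto_const[of x] this] show "z \<longlonglongrightarrow> x"
        by (simp add: z_def [abs_def] power_one_over)
      show "\<forall>\<^sub>F k in sequentially. z k \<noteq> x"
        using \<open>d \<noteq> 0\<close> by (simp add: z_def)
    qed
    ultimately have "eventually (\<lambda>k. ereal (- \<eta>) < ereal ((u (z k) - u x - q \<bullet> (z k - x)) / norm (z k - x))) sequentially"
      by (rule eventually_compose_filterlim)
    then obtain k where "- \<eta> < (u (z k) - u x - q \<bullet> (z k - x)) / norm (z k - x)"
      by (auto dest!: eventually_happens)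
    moreover have "norm (z k - x) > 0"
      using \<open>d \<noteq> 0\<close> by (simp add: z_def)
    ultimately have "- \<eta> * norm (z k - x) < u (z k) - u x - q \<bullet> (z k - x)"
      by (simp only: pos_less_divide_eq)
    then have "2 ^ k * (- \<eta> * norm (z k - x)) < 2 ^ k * (u (z k) - u x - q \<bullet> (z k - x))"
      by (rule mult_strict_left_mono) simp
    moreover have "2 ^ k * (\<eta> * norm (z k - x)) = e"
      using \<open>d \<noteq> 0\<close> by (simp add: z_def \<eta>_def)
    moreover have "2 ^ k * (q \<bullet> (z k - x)) = q \<bullet> d"
      by (simp add: z_def)
    ultimately have "q \<bullet> d - e < 2 ^ k * (u (z k) - u x)"
      by (simp add: algebra_simps)
    moreover have "C * (norm d)\<^sup>2 / 2 * (1 - 1 / 2 ^ k) \<le> C * (norm d)\<^sup>2 / 2 * 1"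
      using \<open>C \<ge> 0\<close> by (intro mult_left_mono) auto
    ultimately show "q \<bullet> d \<le> u y - u x + C / 2 * (norm d)\<^sup>2 + e"
      using iter[of k] unfolding z0 by linarith
  qed
  then show ?thesis
    by (simp add: d_def)
qed simp

lemma hamiltonian_maximizer_eq_gradient:
  assumes F: "compact (F x)" and D: "GDERIV (hamiltonian F x) p :> D"
    and v: "v \<in> F x" "v \<bullet> p = hamiltonian F x p"
  shows "v = D"
proof -
  have "((\<lambda>q. hamiltonian F x q - v \<bullet> q) has_derivative (\<lambda>h. h \<bullet> D - v \<bullet> h)) (at p)"
    using D unfolding gderiv_def by (intro derivative_intros) auto
  moreover have "eventually (\<lambda>q. hamiltonian F x p - v \<bullet> p \<le> hamiltonian F x q - v \<bullet> q) (at p)"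
    using hamiltonian_upper[of F x v, OF F v(1)] v(2) by (intro always_eventually) simp
  ultimately have "(\<lambda>h. h \<bullet> D - v \<bullet> h) = (\<lambda>h. 0)"
    by (rule has_derivative_local_min)
  then have "(D - v) \<bullet> D - v \<bullet> (D - v) = 0"
    by metis
  then have "(D - v) \<bullet> (D - v) = 0"
    by (simp add: inner_diff_left inner_diff_right inner_commute)
  then show ?thesis
    by simp
qed

lemma hamiltonian_maximizers:
  assumes F: "compact (F x)" "F x \<noteq> {}" and D: "\<exists>D. GDERIV (hamiltonian F x) p :> D"
  shows "{v \<in> F x. v \<bullet> p = hamiltonian F x p} = {gradient (hamiltonian F x) p}"
proof -
  obtain v where v: "v \<in> F x" "v \<bullet> p = hamiltonian F x p"
    using hamiltonian_attained[of F x, OF F] by blast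
  have *: "D = v" if "GDERIV (hamiltonian F x) p :> D" for D
    using hamiltonian_maximizer_eq_gradient[of F x, OF F(1) that v] by simp
  have "gradient (hamiltonian F x) p = v"
    unfolding gradient_def using D * by (metis the_equality)
  moreover have "w = v" if "w \<in> F x" "w \<bullet> p = hamiltonian F x p" for w
    using D * hamiltonian_maximizer_eq_gradient[of F x p _ w] F that by blast
  ultimately show ?thesis
    using v by blast
qed

lemma norm_fst_diff_le: "norm (fst w - fst z) \<le> dist w z"
  and norm_snd_diff_le: "norm (snd w - snd z) \<le> dist w z"
  for w z :: "'b::real_normed_vector \<times> 'c::real_normed_vector"
  using dist_fst_le[of w z] dist_snd_le[of w z] by (simp_all add: dist_norm)

locale lipschitz_multifunction_on_compact =
  fixes F :: "'a::euclidean_space \<Rightarrow> 'a set" and K :: "'a set" and L R :: real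
  assumes compact_values: "\<And>x. compact (F x)" and nonempty_values: "\<And>x. F x \<noteq> {}"
    and compact_domain: "compact K" and L_nonneg: "L \<ge> 0"
    and values_bounded: "\<And>x v. x \<in> K \<Longrightarrow> v \<in> F x \<Longrightarrow> norm v \<le> R"
    and infdist_lipschitz: "\<And>v x y. norm v \<le> R \<Longrightarrow> x \<in> K \<Longrightarrow> y \<in> K \<Longrightarrow>
      infdist v (F y) \<le> infdist v (F x) + L * norm (x - y)"
begin

lemma in_values_iff: "v \<in> F x \<longleftrightarrow> infdist v (F x) = 0"
  by (rule in_closed_iff_infdist_zero[OF compact_imp_closed[OF compact_values] nonempty_values])

lemma nearby_value:
  assumes "x \<in> K" "y \<in> K" "v \<in> F x"
  obtains w where "w \<in> F y" "norm (v - w) = infdist v (F y)" "norm (v - w) \<le> L * norm (x - y)"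
proof -
  obtain w where w: "w \<in> F y" "infdist v (F y) = dist v w"
    using infdist_attains_inf[OF compact_imp_closed[OF compact_values] nonempty_values] by blast
  moreover have "infdist v (F y) \<le> L * norm (x - y)"
    using infdist_lipschitz[OF values_bounded[OF assms(1,3)] assms(1,2)] assms(3)
    by (simp add: in_values_iff)
  ultimately show ?thesis
    using that by (simp add: dist_norm)
qed

lemma hamiltonian_lipschitz_state:
  assumes "x \<in> K" "y \<in> K"
  shows "hamiltonian F x p \<le> hamiltonian F y p + L * norm (x - y) * norm p"
proof (rule hamiltonian_le[of F x, OF nonempty_values])
  fix v assume v: "v \<in> F x"
  obtain w where w: "w \<in> F y" "norm (v - w) \<le> L * norm (x - y)"
    using nearby_value[OF assms v] .
  have "v \<bullet> p = w \<bullet> p + (v - w) \<bullet> p"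
    by (simp add: inner_diff_left)
  also have "(v - w) \<bullet> p \<le> norm (v - w) * norm p"
    by (rule norm_cauchy_schwarz)
  also have "\<dots> \<le> L * norm (x - y) * norm p"
    using w(2) by (intro mult_right_mono) auto
  finally show "v \<bullet> p \<le> hamiltonian F y p + L * norm (x - y) * norm p"
    using hamiltonian_upper[of F y w p, OF compact_values w(1)] by simp
qed

lemma R_nonneg: "x \<in> K \<Longrightarrow> R \<ge> 0"
  using nonempty_values[of x] values_bounded[of x] norm_ge_zero order_trans by blast

lemma continuous_on_infdist_values:
  "continuous_on (K \<times> cball 0 R) (\<lambda>z. infdist (snd z) (F (fst z)))"
proof (rule continuous_on_pointwise_lipschitz)
  fix z :: "'a \<times> 'a" assume z: "z \<in> K \<times> cball 0 R"
  have "\<bar>infdist (snd w) (F (fst w)) - infdist (snd z) (F (fst z))\<bar> \<le> (1 + L) * dist w z"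
    if w: "w \<in> K \<times> cball 0 R" for w
  proof -
    have "\<bar>infdist (snd w) (F (fst w)) - infdist (snd z) (F (fst w))\<bar> \<le> dist w z"
      using infdist_triangle_abs[of "snd w" "F (fst w)" "snd z"] dist_snd_le[of w z] by linarith
    moreover have "\<bar>infdist (snd z) (F (fst w)) - infdist (snd z) (F (fst z))\<bar> \<le> L * norm (fst w - fst z)"
      using infdist_lipschitz[of "snd z" "fst w" "fst z"] infdist_lipschitz[of "snd z" "fst z" "fst w"] w z
      by (auto simp: norm_minus_commute)
    moreover have "L * norm (fst w - fst z) \<le> L * dist w z"
      using L_nonneg norm_fst_diff_le[of w z] by (intro mult_left_mono)
    ultimately show ?thesis
      by (simp add: algebra_simps)
  qed
  then show "\<exists>M. \<forall>w\<in>K \<times> cball 0 R.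
      \<bar>infdist (snd w) (F (fst w)) - infdist (snd z) (F (fst z))\<bar> \<le> M * dist w z"
    by blast
qed

lemma continuous_on_hamiltonian:
  "continuous_on (K \<times> UNIV) (\<lambda>z. hamiltonian F (fst z) (snd z))"
proof (rule continuous_on_pointwise_lipschitz)
  fix z :: "'a \<times> 'a" assume z: "z \<in> K \<times> UNIV"
  then have zK: "fst z \<in> K"
    by auto
  let ?H = "hamiltonian F"
  have "\<bar>?H (fst w) (snd w) - ?H (fst z) (snd z)\<bar> \<le> (R + L * norm (snd z)) * dist w z"
    if "w \<in> K \<times> UNIV" for w
  proof -
    have wK: "fst w \<in> K"
      using that by auto
    have "\<bar>?H (fst w) (snd w) - ?H (fst w) (snd z)\<bar> \<le> R * norm (snd w - snd z)"
      using hamiltonian_lipschitz_momentum[of F "fst w" R "snd w" "snd z"]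
        hamiltonian_lipschitz_momentum[of F "fst w" R "snd z" "snd w"]
        compact_values nonempty_values values_bounded[OF wK]
      by (auto simp: norm_minus_commute abs_le_iff)
    moreover have "\<bar>?H (fst w) (snd z) - ?H (fst z) (snd z)\<bar> \<le> L * norm (snd z) * norm (fst w - fst z)"
      using hamiltonian_lipschitz_state[OF wK zK, of "snd z"] hamiltonian_lipschitz_state[OF zK wK, of "snd z"]
      by (auto simp: norm_minus_commute abs_le_iff mult_ac)
    moreover have "R * norm (snd w - snd z) \<le> R * dist w z"
      using R_nonneg[OF wK] norm_snd_diff_le[of w z] by (intro mult_left_mono)
    moreover have "L * norm (snd z) * norm (fst w - fst z) \<le> L * norm (snd z) * dist w z"
      using L_nonneg norm_fst_diff_le[of w z] by (intro mult_left_mono) auto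
    ultimately show ?thesis
      unfolding distrib_right by linarith
  qed
  then show "\<exists>M. \<forall>w\<in>K \<times> UNIV. \<bar>?H (fst w) (snd w) - ?H (fst z) (snd z)\<bar> \<le> M * dist w z"
    by blast
qed

lemma continuous_on_closest_point:
  assumes "\<And>x. convex (F x)"
  shows "continuous_on (K \<times> cball 0 R) (\<lambda>z. closest_point (F (fst z)) (snd z))"
proof (rule continuous_from_closed_graph)
  let ?f = "\<lambda>z. closest_point (F (fst z)) (snd z)"
  let ?A = "(K \<times> cball 0 R) \<times> cball (0::'a) R"
  have f: "?f z \<in> F (fst z)" "dist (snd z) (?f z) = infdist (snd z) (F (fst z))" for z :: "'a \<times> 'a"
  proof -
    have cl: "closed (F (fst z))"
      using compact_values compact_imp_closed by blast
    show 1: "?f z \<in> F (fst z)"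
      by (rule closest_point_in_set[OF cl nonempty_values])
    have "dist (snd z) (?f z) \<le> dist (snd z) w" if "w \<in> F (fst z)" for w
      using closest_point_le[OF cl that] .
    moreover obtain w where "w \<in> F (fst z)" "infdist (snd z) (F (fst z)) = dist (snd z) w"
      using infdist_attains_inf[OF cl nonempty_values] by blast
    ultimately show "dist (snd z) (?f z) = infdist (snd z) (F (fst z))"
      using infdist_le[OF 1, of "snd z"] by fastforce
  qed
  show "?f \<in> K \<times> cball 0 R \<rightarrow> cball 0 R"
    using f(1) values_bounded by force
  have "(\<lambda>z. (z, ?f z)) ` (K \<times> cball 0 R)
      = {w \<in> ?A. infdist (snd w) (F (fst (fst w))) = 0}
        \<inter> {w \<in> ?A. dist (snd (fst w)) (snd w) - infdist (snd (fst w)) (F (fst (fst w))) = 0}" (is "?G = ?B")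
  proof
    show "?G \<subseteq> ?B"
      using f values_bounded by (force simp: in_values_iff)
    show "?B \<subseteq> ?G"
    proof
      fix w assume w: "w \<in> ?B"
      then have wF: "snd w \<in> F (fst (fst w))"
        by (simp add: in_values_iff)
      moreover have "dist (snd (fst w)) (snd w) = infdist (snd (fst w)) (F (fst (fst w)))"
        using w by simp
      then have "\<forall>u\<in>F (fst (fst w)). dist (snd (fst w)) (snd w) \<le> dist (snd (fst w)) u"
        using infdist_le by metis
      ultimately have "snd w = ?f (fst w)"
        using closest_point_unique[OF assms compact_imp_closed[OF compact_values]] by blast
      then show "w \<in> ?G"
        using w by (intro image_eqI[of _ _ "fst w"]) (auto simp: prod_eq_iff)
    qed
  qed
  moreover have "closed ?A"
    using compact_domain by (intro closed_Times closed_cball compact_imp_closed)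
  moreover have "continuous_on ?A (\<lambda>w. infdist (snd w) (F (fst (fst w))))"
    by (rule continuous_on_compose2[OF continuous_on_infdist_values, of ?A "\<lambda>w. (fst (fst w), snd w)", simplified])
       (auto intro!: continuous_intros)
  moreover have "continuous_on ?A (\<lambda>w. infdist (snd (fst w)) (F (fst (fst w))))"
    by (rule continuous_on_compose2[OF continuous_on_infdist_values, of ?A fst]) (auto intro!: continuous_intros)
  ultimately show "closed ?G"
    by (simp only:) (intro closed_Int continuous_closed_preimage_constant continuous_intros; assumption)
qed simp

lemma continuous_on_gradient_hamiltonian:
  assumes P: "compact P" and D: "\<And>x p. x \<in> K \<Longrightarrow> p \<in> P \<Longrightarrow> \<exists>D. GDERIV (hamiltonian F x) p :> D"
  shows "continuous_on (K \<times> P) (\<lambda>z. gradient (hamiltonian F (fst z)) (snd z))"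
proof (rule continuous_from_closed_graph)
  let ?f = "\<lambda>z. gradient (hamiltonian F (fst z)) (snd z)"
  let ?A = "(K \<times> P) \<times> cball (0::'a) R"
  have f: "{v \<in> F x. v \<bullet> p = hamiltonian F x p} = {?f (x, p)}" if "x \<in> K" "p \<in> P" for x p
    using hamiltonian_maximizers[of F x, OF compact_values nonempty_values D[OF that]] by simp
  show "?f \<in> K \<times> P \<rightarrow> cball 0 R"
    using f values_bounded by force
  have "(\<lambda>z. (z, ?f z)) ` (K \<times> P)
      = {w \<in> ?A. infdist (snd w) (F (fst (fst w))) = 0}
        \<inter> {w \<in> ?A. snd w \<bullet> snd (fst w) - hamiltonian F (fst (fst w)) (snd (fst w)) = 0}" (is "?G = ?B")
  proof
    show "?G \<subseteq> ?B"
      using f values_bounded by (force simp: in_values_iff[symmetric])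
    show "?B \<subseteq> ?G"
    proof
      fix w assume w: "w \<in> ?B"
      then have "snd w \<in> {v \<in> F (fst (fst w)). v \<bullet> snd (fst w) = hamiltonian F (fst (fst w)) (snd (fst w))}"
        by (simp add: in_values_iff)
      then have "snd w = ?f (fst w)"
        using f[of "fst (fst w)" "snd (fst w)"] w by auto
      then show "w \<in> ?G"
        using w by (intro image_eqI[of _ _ "fst w"]) (auto simp: prod_eq_iff)
    qed
  qed
  moreover have "closed ?A"
    using compact_domain P by (intro closed_Times closed_cball compact_imp_closed)
  moreover have "continuous_on ?A (\<lambda>w. infdist (snd w) (F (fst (fst w))))"
    by (rule continuous_on_compose2[OF continuous_on_infdist_values, of ?A "\<lambda>w. (fst (fst w), snd w)", simplified])
       (auto intro!: continuous_intros)
  moreover have "continuous_on ?A (\<lambda>w. hamiltonian F (fst (fst w)) (snd (fst w)))"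
    by (rule continuous_on_compose2[OF continuous_on_hamiltonian, of ?A fst]) (auto intro!: continuous_intros)
  ultimately show "closed ?G"
    by (simp only:) (intro closed_Int continuous_closed_preimage_constant continuous_intros; assumption)
qed simp

lemma gradient_hamiltonian_lipschitz:
  assumes P: "compact P" and D: "\<And>x p. x \<in> K \<Longrightarrow> p \<in> P \<Longrightarrow> \<exists>D. GDERIV (hamiltonian F x) p :> D"
    and lip: "\<forall>x\<in>K. \<exists>u>0. \<exists>M. \<forall>p\<in>P.
      M-lipschitz_on (cball x u \<inter> K) (\<lambda>y. gradient (hamiltonian F y) p)"
  obtains M where "M \<ge> 0" "\<And>p x y. p \<in> P \<Longrightarrow> x \<in> K \<Longrightarrow> y \<in> K \<Longrightarrow>
      norm (gradient (hamiltonian F x) p - gradient (hamiltonian F y) p) \<le> M * norm (x - y)"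
proof -
  have loc: "local_lipschitz P K (\<lambda>p y. gradient (hamiltonian F y) p)"
    unfolding local_lipschitz_def
  proof (intro ballI)
    fix x p assume "x \<in> K"
    then obtain u M where "u > 0" "\<forall>p\<in>P. M-lipschitz_on (cball x u \<inter> K) (\<lambda>y. gradient (hamiltonian F y) p)"
      using lip by blast
    then show "\<exists>u>0. \<exists>M. \<forall>p\<in>cball p u \<inter> P. M-lipschitz_on (cball x u \<inter> K) (\<lambda>y. gradient (hamiltonian F y) p)"
      by blast
  qed
  have cont: "continuous_on P (\<lambda>p. gradient (hamiltonian F x) p)" if "x \<in> K" for x
    by (rule continuous_on_compose2[OF continuous_on_gradient_hamiltonian[OF P D], of P "\<lambda>p. (x, p)", simplified])
       (use that in \<open>auto intro!: continuous_intros\<close>)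
  obtain M where M': "\<forall>p\<in>P. M-lipschitz_on K (\<lambda>y. gradient (hamiltonian F y) p)"
    by (rule local_lipschitz_compact_implies_lipschitz[OF loc compact_domain P cont]) (assumption, blast)
  then have M: "norm (gradient (hamiltonian F x) p - gradient (hamiltonian F y) p) \<le> M * norm (x - y)"
    if "p \<in> P" "x \<in> K" "y \<in> K" for p x y
    using lipschitz_onD[OF bspec[OF M' that(1)] that(2,3)] by (simp add: dist_norm)
  show ?thesis
  proof (rule that[of "max M 0"])
    fix p x y assume *: "p \<in> P" "x \<in> K" "y \<in> K"
    have "M * norm (x - y) \<le> max M 0 * norm (x - y)"
      by (intro mult_right_mono) auto
    with M[OF *] show "norm (gradient (hamiltonian F x) p - gradient (hamiltonian F y) p) \<le> max M 0 * norm (x - y)"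
      by simp
  qed simp
qed

end

section \<open>Trajectories and the value function\<close>

lemma (in bounded_bilinear) lipschitz_on_prod:
  assumes f: "A-lipschitz_on {a..b::real} f" and g: "B-lipschitz_on {a..b} g"
  shows "\<exists>C. C-lipschitz_on {a..b} (\<lambda>s. prod (f s) (g s))"
proof -
  obtain k where k: "k > 0" "\<And>x y. norm (prod x y) \<le> norm x * norm y * k"
    using pos_bounded by blast
  have "compact (f ` {a..b})" "compact (g ` {a..b})"
    using lipschitz_on_continuous_on[OF f] lipschitz_on_continuous_on[OF g]
    by (auto intro: compact_continuous_image)
  then obtain Mf Mg where M: "Mf > 0" "\<And>s. s \<in> {a..b} \<Longrightarrow> norm (f s) \<le> Mf"
    "Mg > 0" "\<And>s. s \<in> {a..b} \<Longrightarrow> norm (g s) \<le> Mg"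
    by (metis bounded_pos compact_imp_bounded imageI)
  have AB: "A \<ge> 0" "B \<ge> 0"
    using f g lipschitz_on_nonneg by auto
  have "((Mf * B + A * Mg) * k)-lipschitz_on {a..b} (\<lambda>s. prod (f s) (g s))"
  proof (rule lipschitz_onI)
    fix s t assume st: "s \<in> {a..b}" "t \<in> {a..b}"
    have "prod (f s) (g s) - prod (f t) (g t) = prod (f s) (g s - g t) + prod (f s - f t) (g t)"
      by (simp add: diff_left diff_right)
    then have "norm (prod (f s) (g s) - prod (f t) (g t))
        \<le> norm (f s) * norm (g s - g t) * k + norm (f s - f t) * norm (g t) * k"
      using norm_triangle_mono[OF k(2)[of "f s" "g s - g t"] k(2)[of "f s - f t" "g t"]] by simp
    also have "\<dots> \<le> Mf * (B * dist s t) * k + (A * dist s t) * Mg * k"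
      using st M k AB lipschitz_onD[OF f st] lipschitz_onD[OF g st]
      by (intro add_mono mult_right_mono mult_mono) (auto simp: dist_norm)
    finally show "dist (prod (f s) (g s)) (prod (f t) (g t)) \<le> (Mf * B + A * Mg) * k * dist s t"
      by (simp add: dist_norm algebra_simps)
  qed (use AB M k in simp)
  then show ?thesis
    by blast
qed

lemma lipschitz_on_nonincreasing:
  fixes f :: "real \<Rightarrow> real"
  assumes "a \<le> b" "A-lipschitz_on {a..b} f" "negligible N"
    and "\<And>s. s \<in> {a..b} - N \<Longrightarrow> (f has_vector_derivative f' s) (at s within {a..b})"
    and "\<And>s. s \<in> {a..b} - N \<Longrightarrow> f' s \<le> 0"
  shows "f b \<le> f a"
  using assms absolutely_continuous_on_nonincreasing lipschitz_on_imp_absolutely_continuous_on by blast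

lemma lipschitz_on_gronwall:
  fixes q :: "real \<Rightarrow> real"
  assumes "a \<le> b" and q: "A-lipschitz_on {a..b} q" and N: "negligible N"
    and q': "\<And>s. s \<in> {a..b} - N \<Longrightarrow> (q has_vector_derivative q' s) (at s within {a..b})"
    and le: "\<And>s. s \<in> {a..b} - N \<Longrightarrow> q' s \<le> M * q s"
  shows "q b \<le> q a * exp (M * (b - a))"
proof -
  define E where "E s = exp (- M * (s - a))" for s
  have E': "(E has_real_derivative - M * E s) (at s within {a..b})" for s
    unfolding E_def by (auto intro!: derivative_eq_intros)
  have "continuous_on {a..b} (\<lambda>s. - M * E s)"
    unfolding E_def by (intro continuous_intros)
  then have "bounded ((\<lambda>s. - M * E s) ` {a..b})"
    by (intro compact_imp_bounded compact_continuous_image) auto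
  then obtain B where B: "B > 0" "\<And>s. s \<in> {a..b} \<Longrightarrow> norm (- M * E s) \<le> B"
    unfolding bounded_pos by blast
  have "B-lipschitz_on {a..b} E"
  proof (rule bounded_derivative_imp_lipschitz)
    show "(E has_derivative (\<lambda>h. h * (- M * E s))) (at s within {a..b})" for s
      using E'[of s] unfolding has_field_derivative_def by (subst mult.commute)
    show "onorm (\<lambda>h. h * (- M * E s)) \<le> B" if "s \<in> {a..b}" for s
    proof (rule onorm_le)
      show "norm (h * (- M * E s)) \<le> B * norm h" for h
        by (subst norm_mult, subst mult.commute) (rule mult_right_mono[OF B(2)[OF that] norm_ge_zero])
    qed
  qed (use B in auto)
  then obtain A' where A': "A'-lipschitz_on {a..b} (\<lambda>s. q s * E s)"
    using bounded_bilinear.lipschitz_on_prod[OF bounded_bilinear_mult q] by blast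
  have "q b * E b \<le> q a * E a"
  proof (rule lipschitz_on_nonincreasing[OF \<open>a \<le> b\<close> A' N])
    fix s assume s: "s \<in> {a..b} - N"
    show "((\<lambda>s. q s * E s) has_vector_derivative q' s * E s + (- M * E s) * q s) (at s within {a..b})"
      using DERIV_mult[OF _ E', of q "q' s" s] q'[OF s]
      by (simp add: has_real_derivative_iff_has_vector_derivative)
    have "(q' s - M * q s) * E s \<le> 0"
      using le[OF s] by (intro mult_nonpos_nonneg) (auto simp: E_def)
    then show "q' s * E s + (- M * E s) * q s \<le> 0"
      by (simp add: algebra_simps)
  qed
  then have "q b * exp (- M * (b - a)) * exp (M * (b - a)) \<le> q a * exp (M * (b - a))"
    by (intro mult_right_mono) (auto simp: E_def)
  then show ?thesis
    by (simp add: mult.assoc flip: exp_add)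
qed

lemma lipschitz_on_vanishing:
  fixes p :: "real \<Rightarrow> 'a::euclidean_space"
  assumes p: "A-lipschitz_on {a..b} p" and N: "negligible N"
    and p': "\<And>s. s \<in> {a..b} - N \<Longrightarrow> (p has_vector_derivative p' s) (at s within {a..b})"
    and le: "\<And>s. s \<in> {a..b} - N \<Longrightarrow> norm (p' s) \<le> M * norm (p s)"
    and st: "s \<in> {a..b}" "t \<in> {a..b}" "p s = 0"
  shows "p t = 0"
proof -
  define q where "q s = p s \<bullet> p s" for s
  have *: "q v \<le> q u * exp (2 * M * (v - u)) \<and> q u \<le> q v * exp (2 * M * (v - u))"
    if uv: "u \<in> {a..b}" "v \<in> {a..b}" "u \<le> v" for u v
  proof -
    have sub: "{u..v} \<subseteq> {a..b}"
      using uv by auto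
    obtain B where B: "B-lipschitz_on {u..v} q"
      using bounded_bilinear.lipschitz_on_prod[OF bounded_bilinear_inner p p] lipschitz_on_subset[OF _ sub]
      unfolding q_def by blast
    have q': "(q has_vector_derivative 2 * (p s \<bullet> p' s)) (at s within {u..v})" if "s \<in> {u..v} - N" for s
    proof -
      have "(p has_vector_derivative p' s) (at s within {u..v})"
        using that sub by (intro has_vector_derivative_within_subset[OF p']) auto
      from bounded_bilinear.has_vector_derivative[OF bounded_bilinear_inner this this]
      show ?thesis
        unfolding q_def by (simp add: inner_commute)
    qed
    have bound: "\<bar>2 * (p s \<bullet> p' s)\<bar> \<le> 2 * M * q s" if "s \<in> {u..v} - N" for s
    proof -
      have "\<bar>p s \<bullet> p' s\<bar> \<le> norm (p s) * norm (p' s)"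
        by (rule Cauchy_Schwarz_ineq2)
      also have "\<dots> \<le> norm (p s) * (M * norm (p s))"
        using that sub by (intro mult_left_mono le) auto
      finally show ?thesis
        by (simp add: q_def dot_square_norm power2_eq_square abs_mult mult_ac)
    qed
    have "q v \<le> q u * exp (2 * M * (v - u))"
      by (rule lipschitz_on_gronwall[OF uv(3) B N q']) (use bound in \<open>auto simp: abs_le_iff\<close>)
    moreover have "- q v \<le> - q u * exp (- (2 * M) * (v - u))"
    proof (rule lipschitz_on_gronwall[OF uv(3) _ N])
      show "B-lipschitz_on {u..v} (\<lambda>s. - q s)"
        using B by (simp add: lipschitz_on_minus_iff)
      show "((\<lambda>s. - q s) has_vector_derivative - (2 * (p s \<bullet> p' s))) (at s within {u..v})"
        if "s \<in> {u..v} - N" for s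
        using has_vector_derivative_minus[OF q'[OF that]] .
    qed (use bound in \<open>auto simp: abs_le_iff\<close>)
    then have "q u * exp (- (2 * M) * (v - u)) * exp (2 * M * (v - u)) \<le> q v * exp (2 * M * (v - u))"
      by (intro mult_right_mono) auto
    then have "q u \<le> q v * exp (2 * M * (v - u))"
      by (simp add: mult.assoc flip: exp_add)
    ultimately show ?thesis ..
  qed
  have "q t \<le> 0"
    using *[of s t] *[of t s] st by (cases "s \<le> t") (auto simp: q_def)
  then show ?thesis
    unfolding q_def by (metis inner_gt_zero_iff not_less)
qed

lemma trajectoryE:
  assumes "trajectory F T t x0 x"
  obtains N v where "negligible N"
    "\<And>s. s \<in> {t..T} - N \<Longrightarrow> v s \<in> F (x s)"
    "\<And>s. s \<in> {t..T} - N \<Longrightarrow> (x has_vector_derivative v s) (at s within {t..T})"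
proof -
  obtain N where N: "negligible N"
    "\<And>s. s \<notin> N \<Longrightarrow> s \<in> {t..T} \<longrightarrow> (\<exists>v\<in>F (x s). (x has_vector_derivative v) (at s within {t..T}))"
    using assms unfolding trajectory_def by (auto elim: AE_lebesgueE)
  then have "\<forall>s\<in>{t..T} - N. \<exists>v. v \<in> F (x s) \<and> (x has_vector_derivative v) (at s within {t..T})"
    by blast
  then obtain v where "\<forall>s\<in>{t..T} - N. v s \<in> F (x s) \<and> (x has_vector_derivative v s) (at s within {t..T})"
    by (rule bchoice[THEN exE])
  with N(1) that show ?thesis
    by blast
qed

lemma trajectoryI:
  assumes "A-lipschitz_on {t..T} x" "x t = x0" "negligible N"
    and "\<And>s. s \<in> {t..T} - N \<Longrightarrow> v s \<in> F (x s)"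
    and "\<And>s. s \<in> {t..T} - N \<Longrightarrow> (x has_vector_derivative v s) (at s within {t..T})"
  shows "trajectory F T t x0 x"
  unfolding trajectory_def
  using assms lipschitz_on_imp_absolutely_continuous_on
  by (intro conjI AE_lebesgueI[OF assms(3)]) auto

lemma trajectory_lipschitz:
  assumes growth: "\<And>x v. v \<in> F x \<Longrightarrow> norm v \<le> \<rho> * (1 + norm x)" and "\<rho> > 0"
    and x: "trajectory F T t x0 x"
  shows "\<exists>A. A-lipschitz_on {t..T} x"
proof -
  have ac: "absolutely_continuous_on t T x"
    using x by (simp add: trajectory_def)
  obtain N v where N: "negligible N" and v: "\<And>s. s \<in> {t..T} - N \<Longrightarrow> v s \<in> F (x s)"
    "\<And>s. s \<in> {t..T} - N \<Longrightarrow> (x has_vector_derivative v s) (at s within {t..T})"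
    by (rule trajectoryE[OF x]) blast
  have "compact (x ` {t..T})"
    using absolutely_continuous_on_imp_continuous_on[OF ac] by (intro compact_continuous_image) auto
  then obtain R where R: "R > 0" "\<forall>y\<in>x ` {t..T}. norm y \<le> R"
    using compact_imp_bounded bounded_pos by metis
  have "(\<rho> * (1 + R))-lipschitz_on {t..T} x"
  proof (rule absolutely_continuous_on_lipschitz[OF ac N _ v(2)])
    fix s assume s: "s \<in> {t..T} - N"
    have "norm (v s) \<le> \<rho> * (1 + norm (x s))"
      by (rule growth[OF v(1)[OF s]])
    also have "\<dots> \<le> \<rho> * (1 + R)"
      using R s \<open>\<rho> > 0\<close> by (intro mult_left_mono) auto
    finally show "norm (v s) \<le> \<rho> * (1 + R)" .
  qed (use \<open>\<rho> > 0\<close> R in auto)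
  then show ?thesis
    by blast
qed

lemma trajectory_endpoint_bound:
  fixes x :: "real \<Rightarrow> 'a::euclidean_space"
  assumes growth: "\<And>x v. v \<in> F x \<Longrightarrow> norm v \<le> \<rho> * (1 + norm x)" and "\<rho> > 0" "t \<le> T"
    and x: "trajectory F T t x0 x"
  shows "1 + (norm (x T))\<^sup>2 \<le> (1 + (norm x0)\<^sup>2) * exp (4 * \<rho> * (T - t))"
proof -
  obtain A where A: "A-lipschitz_on {t..T} x"
    using trajectory_lipschitz[OF growth \<open>\<rho> > 0\<close> x] by blast
  obtain N v where N: "negligible N" and v: "\<And>s. s \<in> {t..T} - N \<Longrightarrow> v s \<in> F (x s)"
    "\<And>s. s \<in> {t..T} - N \<Longrightarrow> (x has_vector_derivative v s) (at s within {t..T})"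
    by (rule trajectoryE[OF x]) blast
  define q where "q s = 1 + x s \<bullet> x s" for s
  obtain B where "B-lipschitz_on {t..T} (\<lambda>s. x s \<bullet> x s)"
    using bounded_bilinear.lipschitz_on_prod[OF bounded_bilinear_inner A A] by blast
  from lipschitz_on_add[OF lipschitz_on_constant[of _ 1] this] have B: "(0 + B)-lipschitz_on {t..T} q"
    unfolding q_def [abs_def] .
  have "q T \<le> q t * exp (4 * \<rho> * (T - t))"
  proof (rule lipschitz_on_gronwall[OF \<open>t \<le> T\<close> B N])
    fix s assume s: "s \<in> {t..T} - N"
    from bounded_bilinear.has_vector_derivative[OF bounded_bilinear_inner v(2)[OF s] v(2)[OF s]]
    show "(q has_vector_derivative 2 * (x s \<bullet> v s)) (at s within {t..T})"
      unfolding q_def [abs_def] by (auto intro!: derivative_eq_intros simp: inner_commute)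
    have "x s \<bullet> v s \<le> norm (x s) * norm (v s)"
      by (rule norm_cauchy_schwarz)
    also have "\<dots> \<le> norm (x s) * (\<rho> * (1 + norm (x s)))"
      using growth[OF v(1)[OF s]] by (intro mult_left_mono) auto
    also have "\<dots> = \<rho> * (norm (x s) + (norm (x s))\<^sup>2)"
      by (simp add: algebra_simps power2_eq_square)
    also have "\<dots> \<le> \<rho> * (2 * (1 + (norm (x s))\<^sup>2))"
    proof (intro mult_left_mono)
      have "0 \<le> (norm (x s) - 1)\<^sup>2 + 1 + (norm (x s))\<^sup>2"
        by simp
      then show "norm (x s) + (norm (x s))\<^sup>2 \<le> 2 * (1 + (norm (x s))\<^sup>2)"
        by (simp add: power2_diff)
    qed (use \<open>\<rho> > 0\<close> in simp)
    finally show "2 * (x s \<bullet> v s) \<le> 4 * \<rho> * q s"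
      by (simp add: q_def dot_square_norm algebra_simps)
  qed
  then show ?thesis
    using x by (simp add: q_def dot_square_norm trajectory_def)
qed

lemma value_function_le:
  fixes y :: "real \<Rightarrow> 'a::euclidean_space"
  assumes growth: "\<And>x v. v \<in> F x \<Longrightarrow> norm v \<le> \<rho> * (1 + norm x)" and "\<rho> > 0" "t \<le> T"
    and \<phi>: "locally_lipschitz \<phi>" and y: "trajectory F T t x0 y"
  shows "value_function F \<phi> T t x0 \<le> \<phi> (y T)"
  unfolding value_function_def
proof (rule cInf_lower)
  define R where "R = (1 + (norm x0)\<^sup>2) * exp (4 * \<rho> * (T - t))"
  have "continuous_on UNIV \<phi>"
  proof (rule continuous_at_imp_continuous_on, rule ballI)
    fix x
    obtain u L where u: "u > 0" "L-lipschitz_on (cball x u) \<phi>"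
      using \<phi> unfolding locally_lipschitz_def by blast
    have "continuous_on (ball x u) \<phi>"
      by (rule continuous_on_subset[OF lipschitz_on_continuous_on[OF u(2)] ball_subset_cball])
    then show "isCont \<phi> x"
      using u(1) by (simp add: continuous_on_eq_continuous_at)
  qed
  then have "compact (\<phi> ` cball 0 R)"
    by (intro compact_continuous_image) (auto intro: continuous_on_subset)
  then have bdd: "bdd_below (\<phi> ` cball 0 R)"
    by (intro bounded_imp_bdd_below compact_imp_bounded)
  have "x T \<in> cball 0 R" if "trajectory F T t x0 x" for x
  proof -
    have "1 + (norm (x T))\<^sup>2 \<le> R"
      using trajectory_endpoint_bound[of F \<rho> t T x0 x, OF growth assms(2,3) that] by (simp add: R_def)
    moreover have "2 * norm (x T) \<le> 1 + (norm (x T))\<^sup>2"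
      using zero_le_power2[of "norm (x T) - 1"] by (simp add: power2_diff)
    moreover have "0 \<le> norm (x T)"
      by simp
    ultimately show ?thesis
      unfolding mem_cball_0 by linarith
  qed
  then have "{\<phi> (x T) |x. trajectory F T t x0 x} \<subseteq> \<phi> ` cball 0 R"
    by blast
  then show "bdd_below {\<phi> (x T) |x. trajectory F T t x0 x}"
    by (rule bdd_below_mono[OF bdd])
qed (use y in blast)

lemma trajectory_tail:
  assumes x: "trajectory F T t0 x0 x" and t: "t \<in> {t0..T}"
  shows "trajectory F T t (x t) x"
proof -
  obtain N v where N: "negligible N" and v: "\<And>s. s \<in> {t0..T} - N \<Longrightarrow> v s \<in> F (x s)"
    "\<And>s. s \<in> {t0..T} - N \<Longrightarrow> (x has_vector_derivative v s) (at s within {t0..T})"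
    by (rule trajectoryE[OF x]) blast
  have "absolutely_continuous_on t T x"
    using x t by (auto simp: trajectory_def intro: absolutely_continuous_on_subinterval)
  moreover have "(x has_vector_derivative v s) (at s within {t..T})" "v s \<in> F (x s)"
    if "s \<in> {t..T} - N" for s
    using has_vector_derivative_within_subset[OF v(2), of s "{t..T}"] v(1)[of s] that t by auto
  ultimately show ?thesis
    unfolding trajectory_def by (intro conjI AE_lebesgueI[OF N]) auto
qed

lemma trajectory_concat:
  assumes growth: "\<And>x v. v \<in> F x \<Longrightarrow> norm v \<le> \<rho> * (1 + norm x)" and "\<rho> > 0"
    and x: "trajectory F T t0 x0 x" and t: "t \<in> {t0..T}" and y: "trajectory F T t (x t) y"
  shows "trajectory F T t0 x0 (\<lambda>s. if s \<le> t then x s else y s)" (is "trajectory F T t0 x0 ?z")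
proof -
  obtain A where A: "A-lipschitz_on {t0..T} x"
    using trajectory_lipschitz[OF growth \<open>\<rho> > 0\<close> x] by blast
  obtain B where B: "B-lipschitz_on {t..T} y"
    using trajectory_lipschitz[OF growth \<open>\<rho> > 0\<close> y] by blast
  obtain N v where N: "negligible N" and v: "\<And>s. s \<in> {t0..T} - N \<Longrightarrow> v s \<in> F (x s)"
    "\<And>s. s \<in> {t0..T} - N \<Longrightarrow> (x has_vector_derivative v s) (at s within {t0..T})"
    by (rule trajectoryE[OF x]) blast
  obtain N' v' where N': "negligible N'" and v': "\<And>s. s \<in> {t..T} - N' \<Longrightarrow> v' s \<in> F (y s)"
    "\<And>s. s \<in> {t..T} - N' \<Longrightarrow> (y has_vector_derivative v' s) (at s within {t..T})"
    by (rule trajectoryE[OF y]) blast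
  have "x t = y t"
    using y by (simp add: trajectory_def)
  then have lip: "(max A B)-lipschitz_on {t0..T} ?z"
    using lipschitz_on_subset[OF A, of "{t0..t}"] B t by (intro lipschitz_on_concat_max) auto
  show ?thesis
  proof (rule trajectoryI[OF lip])
    show "?z t0 = x0"
      using x t by (simp add: trajectory_def)
    show "negligible (insert t (N \<union> N'))"
      using N N' by simp
    fix s assume s: "s \<in> {t0..T} - insert t (N \<union> N')"
    show "(if s \<le> t then v s else v' s) \<in> F (?z s)"
      using s v(1)[of s] v'(1)[of s] by auto
    show "(?z has_vector_derivative (if s \<le> t then v s else v' s)) (at s within {t0..T})"
    proof (cases "s < t")
      case True
      have "(?z has_vector_derivative v s) (at s within {t0..T})"
        by (rule has_vector_derivative_transform_within[of x _ _ _ "t - s"])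
          (use True s v(2)[of s] in \<open>auto simp: dist_real_def\<close>)
      then show ?thesis
        using True by simp
    next
      case False
      then have st: "s > t"
        using s by auto
      have "at s within {t0..T} = at s within {t..T}"
        by (rule at_within_nhd[of s "{t<..}"]) (use st t in auto)
      moreover have "(?z has_vector_derivative v' s) (at s within {t..T})"
        by (rule has_vector_derivative_transform_within[of y _ _ _ "s - t"])
          (use st s v'(2)[of s] in \<open>auto simp: dist_real_def\<close>)
      ultimately show ?thesis
        using st by simp
    qed
  qed
qed

lemma value_function_optimal_solution:
  assumes growth: "\<And>x v. v \<in> F x \<Longrightarrow> norm v \<le> \<rho> * (1 + norm x)" and "\<rho> > 0"
    and opt: "optimal_solution F \<phi> T t0 x0 x" and t: "t \<in> {t0..T}"
  shows "value_function F \<phi> T t (x t) = \<phi> (x T)"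
  unfolding value_function_def
proof (rule cInf_eq_minimum)
  have x: "trajectory F T t0 x0 x" and le: "\<And>y. trajectory F T t0 x0 y \<Longrightarrow> \<phi> (x T) \<le> \<phi> (y T)"
    using opt by (auto simp: optimal_solution_def)
  show "\<phi> (x T) \<in> {\<phi> (y T) |y. trajectory F T t (x t) y}"
    using trajectory_tail[OF x t] by blast
  fix c assume "c \<in> {\<phi> (y T) |y. trajectory F T t (x t) y}"
  then obtain y where c: "c = \<phi> (y T)" and y: "trajectory F T t (x t) y"
    by blast
  have "\<phi> (x T) \<le> \<phi> (if T \<le> t then x T else y T)"
    using le[OF trajectory_concat[OF growth \<open>\<rho> > 0\<close> x t y]] by simp
  moreover have "T \<le> t \<Longrightarrow> x T = y T"
    using t y by (auto simp: trajectory_def)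
  ultimately show "\<phi> (x T) \<le> c"
    by (auto simp: c split: if_splits)
qed

lemma indefinite_integral_lipschitz:
  fixes v :: "real \<Rightarrow> 'a::euclidean_space"
  assumes v: "\<And>s. s \<in> {a..b} \<Longrightarrow> (v has_integral (y s - y0)) {a..s}"
    and R: "\<And>s. s \<in> {a..b} \<Longrightarrow> norm (v s) \<le> R" "R \<ge> 0"
  shows "R-lipschitz_on {a..b} y"
proof (rule lipschitz_onI)
  have *: "dist (y s) (y t) \<le> R * dist s t" if st: "s \<in> {a..b}" "t \<in> {a..b}" "s \<le> t" for s t
  proof -
    have vt: "v integrable_on {a..t}"
      using v[OF st(2)] by blast
    have "integral {a..s} v + integral {s..t} v = integral {a..t} v"
      using st vt by (intro Henstock_Kurzweil_Integration.integral_combine) auto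
    then have "integral {s..t} v = y t - y s"
      using integral_unique[OF v[OF st(1)]] integral_unique[OF v[OF st(2)]] by (simp add: algebra_simps)
    moreover have "v integrable_on {s..t}"
      using integrable_subinterval_real[OF vt, of s t] st by auto
    ultimately have "(v has_integral (y t - y s)) (cbox s t)"
      by (simp add: has_integral_iff)
    then have "norm (y t - y s) \<le> R * measure lborel (cbox s t)"
      by (rule has_integral_bound[OF R(2)]) (use R(1) st in auto)
    then show ?thesis
      using st by (simp add: dist_norm norm_minus_commute)
  qed
  show "dist (y s) (y t) \<le> R * dist s t" if "s \<in> {a..b}" "t \<in> {a..b}" for s t
    using *[of s t] *[of t s] that by (cases "s \<le> t") (auto simp: dist_commute)
qed (fact R(2))

lemma indefinite_integral_ae_derivative:
  fixes v :: "real \<Rightarrow> 'a::euclidean_space"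
  assumes v: "\<And>s. s \<in> {a..b} \<Longrightarrow> (v has_integral (y s - y0)) {a..s}"
  obtains N where "negligible N"
    "\<And>s. s \<in> {a..b} - N \<Longrightarrow> (y has_vector_derivative v s) (at s within {a..b})"
proof (cases "a \<le> b")
  case True
  then have "v integrable_on {a..b}"
    using v[of b] by auto
  then obtain N where N: "negligible N"
    "\<And>s. s \<in> {a..b} - N \<Longrightarrow> ((\<lambda>s. integral {a..s} v) has_vector_derivative v s) (at s within {a..b})"
    by (rule has_vector_derivative_integral_ae) blast
  have "(y has_vector_derivative v s) (at s within {a..b})" if s: "s \<in> {a..b} - N" for s
  proof (rule has_vector_derivative_transform_within[of "\<lambda>s. y0 + integral {a..s} v" _ _ _ 1])
    show "((\<lambda>s. y0 + integral {a..s} v) has_vector_derivative v s) (at s within {a..b})"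
      using has_vector_derivative_add[OF has_vector_derivative_const[of y0] N(2)[OF s]] by simp
    show "y0 + integral {a..s'} v = y s'" if "s' \<in> {a..b}" for s'
      using integral_unique[OF v[OF that]] by simp
  qed (use s in auto)
  with N(1) that show ?thesis
    by blast
next
  case False
  then show ?thesis
    using that[of "{}"] by simp
qed

section \<open>Perturbed trajectories\<close>

context lipschitz_multifunction_on_compact
begin

text \<open>For \<open>p \<noteq> 0\<close> the maximizer is unique; for \<open>p = 0\<close> one projects onto \<open>F x\<close>.\<close>

lemma maximizer_selection:
  fixes a b :: real
  assumes convex: "\<And>x. convex (F x)" and p: "continuous_on {a..b} p"
    and cases: "(\<forall>s\<in>{a..b}. p s \<noteq> 0) \<or> (\<forall>s\<in>{a..b}. p s = 0)"
    and D: "\<And>x p. x \<in> K \<Longrightarrow> p \<noteq> 0 \<Longrightarrow> \<exists>D. GDERIV (hamiltonian F x) p :> D"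
    and lip: "\<And>P. compact P \<Longrightarrow> P \<subseteq> - {0} \<Longrightarrow> \<forall>x\<in>K. \<exists>u>0. \<exists>M. \<forall>p\<in>P.
      M-lipschitz_on (cball x u \<inter> K) (\<lambda>y. gradient (hamiltonian F y) p)"
  obtains G M where "M \<ge> 0"
    "continuous_on ({a..b} \<times> K \<times> cball 0 R) (\<lambda>(s, x, v). G s x v)"
    "\<And>s x v. s \<in> {a..b} \<Longrightarrow> x \<in> K \<Longrightarrow> v \<in> cball 0 R \<Longrightarrow> G s x v \<in> F x \<and> G s x v \<bullet> p s = hamiltonian F x (p s)"
    "\<And>s x y v. s \<in> {a..b} \<Longrightarrow> x \<in> K \<Longrightarrow> y \<in> K \<Longrightarrow> v \<in> F x \<Longrightarrow> v \<bullet> p s = hamiltonian F x (p s) \<Longrightarrow>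
      norm (G s y v - v) \<le> M * norm (x - y)"
proof (cases "\<forall>s\<in>{a..b}. p s \<noteq> 0")
  case True
  define P where "P = p ` {a..b}"
  have P: "compact P" "P \<subseteq> - {0}"
    using compact_continuous_image[OF p compact_Icc] True by (auto simp: P_def)
  have DP: "\<exists>D. GDERIV (hamiltonian F x) p :> D" if "x \<in> K" "p \<in> P" for x p
    using D[OF that(1), of p] that(2) P(2) by auto
  obtain M where M: "M \<ge> 0" "\<And>p x y. p \<in> P \<Longrightarrow> x \<in> K \<Longrightarrow> y \<in> K \<Longrightarrow>
      norm (gradient (hamiltonian F x) p - gradient (hamiltonian F y) p) \<le> M * norm (x - y)"
    by (rule gradient_hamiltonian_lipschitz[OF P(1) DP lip[OF P]]) blast+
  have max: "{v \<in> F x. v \<bullet> p s = hamiltonian F x (p s)} = {gradient (hamiltonian F x) (p s)}"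
    if "x \<in> K" "s \<in> {a..b}" for x s
    using hamiltonian_maximizers[of F x, OF compact_values nonempty_values] D that True by blast
  show ?thesis
  proof (rule that[of M "\<lambda>s x v. gradient (hamiltonian F x) (p s)"])
    have "continuous_on ({a..b} \<times> K \<times> cball (0::'a) R) (\<lambda>z. (fst (snd z), p (fst z)))"
      by (intro continuous_intros continuous_on_compose2[OF p]) auto
    moreover have "(\<lambda>z. (fst (snd z), p (fst z))) ` ({a..b} \<times> K \<times> cball (0::'a) R) \<subseteq> K \<times> P"
      by (auto simp: P_def)
    ultimately have "continuous_on ({a..b} \<times> K \<times> cball (0::'a) R)
        (\<lambda>z. gradient (hamiltonian F (fst (snd z))) (p (fst z)))"
      using continuous_on_compose2[OF continuous_on_gradient_hamiltonian[OF P(1) DP]] by fastforce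
    then show "continuous_on ({a..b} \<times> K \<times> cball (0::'a) R) (\<lambda>(s, x, v). gradient (hamiltonian F x) (p s))"
      by (simp add: case_prod_unfold)
    fix s x y v assume *: "s \<in> {a..b}" "x \<in> K"
    show "gradient (hamiltonian F x) (p s) \<in> F x \<and>
        gradient (hamiltonian F x) (p s) \<bullet> p s = hamiltonian F x (p s)"
      using max[OF *(2,1)] by blast
    assume "y \<in> K" "v \<in> F x" "v \<bullet> p s = hamiltonian F x (p s)"
    moreover from this have "v = gradient (hamiltonian F x) (p s)"
      using max[OF *(2,1)] by blast
    ultimately show "norm (gradient (hamiltonian F y) (p s) - v) \<le> M * norm (x - y)"
      using M(2)[of "p s" y x] * by (simp add: P_def norm_minus_commute)
  qed (fact M(1))
next
  case False
  then have p0: "p s = 0" if "s \<in> {a..b}" for s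
    using cases that by blast
  have H0: "hamiltonian F x 0 = 0" for x
    using nonempty_values by (simp add: hamiltonian_def)
  have cl: "closed (F x)" for x
    using compact_values compact_imp_closed by blast
  show ?thesis
  proof (rule that[of L "\<lambda>s x v. closest_point (F x) v"])
    have "continuous_on ({a..b} \<times> K \<times> cball (0::'a) R) (\<lambda>z. closest_point (F (fst (snd z))) (snd (snd z)))"
      by (rule continuous_on_compose2[OF continuous_on_closest_point[OF convex], of _ snd])
        (auto intro!: continuous_intros)
    then show "continuous_on ({a..b} \<times> K \<times> cball (0::'a) R) (\<lambda>(s, x, v). closest_point (F x) v)"
      by (simp add: case_prod_unfold)
    fix s x y v assume *: "s \<in> {a..b}" "x \<in> K"
    show "closest_point (F x) v \<in> F x \<and> closest_point (F x) v \<bullet> p s = hamiltonian F x (p s)"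
      using closest_point_in_set[OF cl nonempty_values] p0[OF *(1)] H0 by simp
    assume "y \<in> K" "v \<in> F x"
    then obtain w where w: "w \<in> F y" "norm (v - w) \<le> L * norm (x - y)"
      using nearby_value[OF *(2)] by metis
    then show "norm (closest_point (F y) v - v) \<le> L * norm (x - y)"
      using closest_point_le[OF cl w(1), of v] by (simp add: dist_norm norm_minus_commute)
  qed (fact L_nonneg)
qed

lemma perturbed_trajectory:
  assumes "t \<le> T" and "M \<ge> 0" and "C \<ge> 0"
    and tube: "\<And>s. s \<in> {t..T} \<Longrightarrow> cball (xbar s) r \<subseteq> K"
    and h: "norm h * exp (M * (T - t)) \<le> r"
    and p: "A-lipschitz_on {t..T} p" and N: "negligible N"
    and p': "\<And>s. s \<in> {t..T} - N \<Longrightarrow> (p has_vector_derivative w s) (at s within {t..T})"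
    and v0: "\<And>s. s \<in> {t..T} \<Longrightarrow> v0 s \<in> F (xbar s) \<and> v0 s \<bullet> p s = hamiltonian F (xbar s) (p s)"
    and xbar: "\<And>s. s \<in> {t..T} \<Longrightarrow> (v0 has_integral (xbar s - xbar t)) {t..s}"
    and contG: "continuous_on ({t..T} \<times> K \<times> cball 0 R) (\<lambda>(s, x, v). G s x v)"
    and G: "\<And>s x v. s \<in> {t..T} \<Longrightarrow> x \<in> K \<Longrightarrow> v \<in> cball 0 R \<Longrightarrow>
      G s x v \<in> F x \<and> G s x v \<bullet> p s = hamiltonian F x (p s)"
    and lipG: "\<And>s x y v. s \<in> {t..T} \<Longrightarrow> x \<in> K \<Longrightarrow> y \<in> K \<Longrightarrow> v \<in> F x \<Longrightarrow>
      v \<bullet> p s = hamiltonian F x (p s) \<Longrightarrow> norm (G s y v - v) \<le> M * norm (x - y)"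
    and below: "\<And>s y. s \<in> {t..T} - N \<Longrightarrow> y \<in> K \<Longrightarrow>
      hamiltonian F y (p s) - hamiltonian F (xbar s) (p s)
        \<ge> - w s \<bullet> (y - xbar s) - C * (norm (y - xbar s))\<^sup>2"
  obtains y where "trajectory F T t (xbar t + h) y"
    "norm (y T - xbar T) \<le> norm h * exp (M * (T - t))"
    "- p T \<bullet> (y T - xbar T) \<le> - p t \<bullet> h + C * (norm h * exp (M * (T - t)))\<^sup>2 * (T - t)"
proof -
  define S where "S s x = {v \<in> F x. v \<bullet> p s = hamiltonian F x (p s)}" for s x
  have r: "r \<ge> 0"
    using h by (meson dual_order.trans exp_ge_zero mult_nonneg_nonneg norm_ge_zero)
  have xK: "xbar s \<in> K" if "s \<in> {t..T}" for s
    using tube[OF that] r by (meson centre_in_cball subsetD)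
  have R: "R \<ge> 0"
    using R_nonneg[OF xK[of t]] \<open>t \<le> T\<close> by simp
  have clS: "closed (S s x)" for s x
  proof -
    have "closed (F x)"
      using compact_values compact_imp_closed by blast
    then have "closed {v \<in> F x. v \<bullet> p s = hamiltonian F x (p s)}"
      by (intro continuous_closed_preimage_constant continuous_intros)
    then show ?thesis
      by (simp add: S_def)
  qed
  obtain y v where v: "\<And>s. s \<in> {t..T} \<Longrightarrow> v s \<in> S s (y s)"
    and y: "\<And>s. s \<in> {t..T} \<Longrightarrow> (v has_integral (y s - (xbar t + h))) {t..s}"
    and yx: "\<And>s. s \<in> {t..T} \<Longrightarrow> norm (y s - xbar s) \<le> norm h * exp (M * (s - t))"
  proof (rule filippov[OF \<open>M \<ge> 0\<close> contG, of S xbar r h v0])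
    show "S s x \<subseteq> cball 0 R" if "x \<in> K" for s x
      using values_bounded[OF that] by (auto simp: S_def)
    show "norm (G s y v - v) \<le> M * norm (x - y)"
      if "s \<in> {t..T}" "x \<in> K" "y \<in> K" "v \<in> S s x" for s x y v
      using lipG that by (simp add: S_def)
    show "G s x v \<in> S s x" if "s \<in> {t..T}" "x \<in> K" "v \<in> cball 0 R" for s x v
      using G[OF that] by (simp add: S_def)
    show "v0 s \<in> S s (xbar s)" if "s \<in> {t..T}" for s
      using v0[OF that] by (simp add: S_def)
  qed (use clS tube h xbar in auto)
  define \<eta> where "\<eta> = norm h * exp (M * (T - t))"
  have y\<eta>: "norm (y s - xbar s) \<le> \<eta>" if "s \<in> {t..T}" for s
  proof -
    have "norm h * exp (M * (s - t)) \<le> \<eta>"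
      using that \<open>M \<ge> 0\<close> unfolding \<eta>_def by (intro mult_left_mono) (auto intro: mult_left_mono)
    with yx[OF that] show ?thesis
      by simp
  qed
  have yK: "y s \<in> K" if "s \<in> {t..T}" for s
  proof -
    have "y s \<in> cball (xbar s) r"
      using y\<eta>[OF that] h by (simp add: dist_norm norm_minus_commute \<eta>_def)
    then show ?thesis
      using tube[OF that] by blast
  qed
  have vF: "v s \<in> F (y s)" "v s \<bullet> p s = hamiltonian F (y s) (p s)" if "s \<in> {t..T}" for s
    using v[OF that] by (auto simp: S_def)
  have ylip: "R-lipschitz_on {t..T} y"
    by (rule indefinite_integral_lipschitz[OF y _ R]) (use vF(1) values_bounded yK in auto)
  have xlip: "R-lipschitz_on {t..T} xbar"
    by (rule indefinite_integral_lipschitz[OF xbar _ R]) (use v0 values_bounded xK in auto)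
  obtain N1 where N1: "negligible N1"
    "\<And>s. s \<in> {t..T} - N1 \<Longrightarrow> (y has_vector_derivative v s) (at s within {t..T})"
    using indefinite_integral_ae_derivative[OF y] by metis
  obtain N2 where N2: "negligible N2"
    "\<And>s. s \<in> {t..T} - N2 \<Longrightarrow> (xbar has_vector_derivative v0 s) (at s within {t..T})"
    using indefinite_integral_ae_derivative[OF xbar] by metis
  have y0: "y t = xbar t + h"
    using y[of t] \<open>t \<le> T\<close> has_integral_unique[OF _ has_integral_refl(2)[of v t]] by fastforce
  have traj: "trajectory F T t (xbar t + h) y"
    by (rule trajectoryI[where N = N1 and v = v, OF ylip y0 N1(1) _ N1(2)]) (use vF in auto)
  obtain B where B: "B-lipschitz_on {t..T} (\<lambda>s. p s \<bullet> (y s - xbar s))"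
    using bounded_bilinear.lipschitz_on_prod[OF bounded_bilinear_inner p lipschitz_on_diff[OF ylip xlip]]
    by blast
  define g where "g s = - (p s \<bullet> (y s - xbar s)) + (- (C * \<eta>\<^sup>2 * s))" for s
  have glip: "(B + \<bar>C * \<eta>\<^sup>2\<bar> * 1)-lipschitz_on {t..T} g"
    unfolding g_def
    by (intro lipschitz_on_add lipschitz_on_minus lipschitz_on_cmult_real lipschitz_on_id B)
  have "g T \<le> g t"
  proof (rule lipschitz_on_nonincreasing[OF \<open>t \<le> T\<close> glip])
    show "negligible (N \<union> N1 \<union> N2)"
      using N N1 N2 by simp
    fix s assume s: "s \<in> {t..T} - (N \<union> N1 \<union> N2)"
    then have sT: "s \<in> {t..T}"
      by blast
    have "((\<lambda>s. p s \<bullet> (y s - xbar s)) has_vector_derivative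
        p s \<bullet> (v s - v0 s) + w s \<bullet> (y s - xbar s)) (at s within {t..T})"
      by (rule bounded_bilinear.has_vector_derivative[OF bounded_bilinear_inner p'
            has_vector_derivative_diff[OF N1(2) N2(2)]]) (use s in auto)
    moreover have "((\<lambda>s. C * \<eta>\<^sup>2 * s) has_vector_derivative C * \<eta>\<^sup>2) (at s within {t..T})"
      by (auto intro!: derivative_eq_intros simp flip: has_real_derivative_iff_has_vector_derivative)
    ultimately show "(g has_vector_derivative
        - (p s \<bullet> (v s - v0 s) + w s \<bullet> (y s - xbar s)) + (- (C * \<eta>\<^sup>2))) (at s within {t..T})"
      unfolding g_def by (intro has_vector_derivative_add has_vector_derivative_minus)
    have "p s \<bullet> (v s - v0 s) = hamiltonian F (y s) (p s) - hamiltonian F (xbar s) (p s)"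
      using vF(2)[OF sT] v0[OF sT] by (simp add: inner_diff_right inner_commute)
    moreover have "\<dots> \<ge> - w s \<bullet> (y s - xbar s) - C * (norm (y s - xbar s))\<^sup>2"
      using s by (intro below yK sT) auto
    moreover have "C * (norm (y s - xbar s))\<^sup>2 \<le> C * \<eta>\<^sup>2"
      using \<open>C \<ge> 0\<close> y\<eta>[OF sT] by (intro mult_left_mono power_mono) auto
    ultimately show "- (p s \<bullet> (v s - v0 s) + w s \<bullet> (y s - xbar s)) + (- (C * \<eta>\<^sup>2)) \<le> 0"
      by simp
  qed
  then have "- p T \<bullet> (y T - xbar T) \<le> - p t \<bullet> h + C * \<eta>\<^sup>2 * (T - t)"
    by (simp add: g_def y0 algebra_simps)
  with traj y\<eta>[of T] \<open>t \<le> T\<close> show ?thesis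
    using that unfolding \<eta>_def by simp
qed

end

lemma frechet_subgradient_norm_le:
  fixes u :: "'a::real_inner \<Rightarrow> real"
  assumes "semiconvex_on K C u" "C \<ge> 0" "convex K" "cball x 1 \<subseteq> K" "M \<ge> 0"
    and q: "q \<in> frechet_subdifferential u x"
    and lip: "\<And>y. y \<in> K \<Longrightarrow> u y - u x \<le> M * norm (y - x)"
  shows "norm q \<le> M + C / 2"
proof (cases "q = 0")
  case False
  then have n: "norm (sgn q) = 1"
    by (simp add: norm_sgn)
  have K: "x \<in> K" "x + sgn q \<in> K"
    using assms(4) n by (auto simp: dist_norm)
  have "u (x + sgn q) - u x \<ge> q \<bullet> sgn q - C / 2"
    using semiconvex_on_frechet_subdifferential[OF assms(1,2,3) K q] n by simp
  moreover have "u (x + sgn q) - u x \<le> M"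
    using lip[OF K(2)] n by simp
  moreover have "q \<bullet> sgn q = norm q"
    using False by (simp add: sgn_div_norm dot_square_norm power2_eq_square)
  ultimately show ?thesis
    by simp
qed (use assms in simp)

theorem theorem3p1:
  fixes F :: "real ^ 'n \<Rightarrow> (real ^ 'n) set"
    and \<phi> :: "real ^ 'n \<Rightarrow> real"
    and T t0 :: real
    and x0 :: "real ^ 'n"
    and xbar pbar :: "real \<Rightarrow> real ^ 'n"
  assumes "T > 0" and "t0 \<in> {0..T}"
    and F_values: "\<And>x. F x \<noteq> {} \<and> convex (F x) \<and> compact (F x)"
    and F_lipschitz: "locally_lipschitz_multifunction F"
    and F_growth: "\<exists>\<rho>>0. \<forall>x. \<forall>v\<in>F x. norm v \<le> \<rho> * (1 + norm x)"
    and H_semiconvex: "\<And>K. K \<noteq> {} \<Longrightarrow> convex K \<Longrightarrow> compact K \<Longrightarrow>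
      \<exists>c\<ge>0. \<forall>p. semiconvex_on K (c * norm p) (\<lambda>x. hamiltonian F x p)"
    and H_gradient_exists: "\<And>K. K \<noteq> {} \<Longrightarrow> convex K \<Longrightarrow> compact K \<Longrightarrow>
      \<forall>x\<in>K. \<forall>p. p \<noteq> 0 \<longrightarrow> (\<exists>D. GDERIV (hamiltonian F x) p :> D)"
    and H_gradient_lipschitz: "\<And>K P. K \<noteq> {} \<Longrightarrow> convex K \<Longrightarrow> compact K \<Longrightarrow>
      compact P \<Longrightarrow> P \<subseteq> - {0} \<Longrightarrow>
      \<forall>x\<in>K. \<exists>u>0. \<exists>L. \<forall>p\<in>P.
        L-lipschitz_on (cball x u \<inter> K) (\<lambda>y. gradient (hamiltonian F y) p)"
    and \<phi>_lipschitz: "locally_lipschitz \<phi>"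
    and optimal: "optimal_solution F \<phi> T t0 x0 xbar"
    and pbar_ac: "absolutely_continuous_on t0 T pbar"
    and hamiltonian_inclusion: "AE t in lebesgue. t \<in> {t0..T} \<longrightarrow>
      (\<exists>w v. (pbar has_vector_derivative w) (at t within {t0..T}) \<and>
             (xbar has_vector_derivative v) (at t within {t0..T}) \<and>
             - w \<in> frechet_subdifferential (\<lambda>x. hamiltonian F x (pbar t)) (xbar t) \<and>
             v \<in> clarke_gradient (hamiltonian F (xbar t)) (pbar t))"
    and transversality: "- pbar T \<in> proximal_superdifferential \<phi> (xbar T)"
  shows "(\<exists>c0>0. \<exists>r>0. \<forall>t\<in>{t0..T}. \<forall>h\<in>cball 0 r.
            value_function F \<phi> T t (xbar t + h) - value_function F \<phi> T t (xbar t)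
              \<le> (- pbar t) \<bullet> h + c0 * (norm h)\<^sup>2)
       \<and> (\<forall>t\<in>{t0..T}.
            - pbar t \<in> proximal_superdifferential (value_function F \<phi> T t) (xbar t))"
proof -
  have compact_F: "\<And>x. compact (F x)" and nonempty_F: "\<And>x. F x \<noteq> {}" and convex_F: "\<And>x. convex (F x)"
    using F_values by auto
  have t0T: "t0 \<le> T"
    using \<open>t0 \<in> {0..T}\<close> by simp
  obtain \<rho> where "\<rho> > 0" and growth: "\<And>x v. v \<in> F x \<Longrightarrow> norm v \<le> \<rho> * (1 + norm x)"
    using F_growth by blast
  have xbar: "trajectory F T t0 x0 xbar"
    using optimal by (simp add: optimal_solution_def)
  have xbar_ac: "absolutely_continuous_on t0 T xbar"
    using xbar by (simp add: trajectory_def)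
  have "bounded (xbar ` {t0..T})" "bounded (pbar ` {t0..T})"
    using absolutely_continuous_on_imp_continuous_on[OF xbar_ac]
      absolutely_continuous_on_imp_continuous_on[OF pbar_ac]
    by (auto intro!: compact_imp_bounded compact_continuous_image)
  then obtain Rx Rp where "Rx > 0" "\<forall>y\<in>xbar ` {t0..T}. norm y \<le> Rx"
      and "Rp > 0" "\<forall>y\<in>pbar ` {t0..T}. norm y \<le> Rp"
    unfolding bounded_pos by blast
  then have Rx: "norm (xbar s) \<le> Rx" and Rp: "norm (pbar s) \<le> Rp" if "s \<in> {t0..T}" for s
    using that by auto
  define K :: "(real ^ 'n) set" where "K = cball 0 (Rx + 1)"
  define R where "R = \<rho> * (2 + Rx)"
  have K: "K \<noteq> {}" "convex K" "compact K"
    using \<open>Rx > 0\<close> by (auto simp: K_def)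
  have tube: "cball (xbar s) 1 \<subseteq> K" if "s \<in> {t0..T}" for s
  proof
    fix x assume "x \<in> cball (xbar s) 1"
    then show "x \<in> K"
      using Rx[OF that] norm_triangle_sub[of x "xbar s"] by (simp add: K_def dist_norm norm_minus_commute)
  qed
  have xK: "xbar s \<in> K" if "s \<in> {t0..T}" for s
    using tube[OF that] by (auto simp: subset_iff)
  have R: "norm v \<le> R" if "x \<in> K" "v \<in> F x" for x v
  proof -
    have "norm v \<le> \<rho> * (1 + norm x)"
      by (rule growth[OF that(2)])
    also have "\<dots> \<le> R"
      using that(1) \<open>\<rho> > 0\<close> unfolding R_def K_def by (intro mult_left_mono) auto
    finally show ?thesis .
  qed
  obtain L where L: "L \<ge> 0" "\<And>v x y. norm v \<le> R \<Longrightarrow> x \<in> K \<Longrightarrow> y \<in> K \<Longrightarrow>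
      infdist v (F y) \<le> infdist v (F x) + L * norm (x - y)"
    by (rule locally_lipschitz_multifunction_infdist[OF compact_F nonempty_F F_lipschitz K(3)]) blast
  interpret lipschitz_multifunction_on_compact F K L R
    by unfold_locales (use compact_F nonempty_F K(3) L R in auto)
  obtain c where "c \<ge> 0" and semiconvex: "\<And>p. semiconvex_on K (c * norm p) (\<lambda>x. hamiltonian F x p)"
    using H_semiconvex[OF K] by blast
  obtain N0 where N0: "negligible N0" "\<And>s. s \<notin> N0 \<Longrightarrow> s \<in> {t0..T} \<longrightarrow>
      (\<exists>w v. (pbar has_vector_derivative w) (at s within {t0..T}) \<and>
             (xbar has_vector_derivative v) (at s within {t0..T}) \<and>
             - w \<in> frechet_subdifferential (\<lambda>x. hamiltonian F x (pbar s)) (xbar s) \<and>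
             v \<in> clarke_gradient (hamiltonian F (xbar s)) (pbar s))"
    using AE_lebesgueE[OF hamiltonian_inclusion] by blast
  obtain N1 v1 where N1: "negligible N1" "\<And>s. s \<in> {t0..T} - N1 \<Longrightarrow> v1 s \<in> F (xbar s)"
    "\<And>s. s \<in> {t0..T} - N1 \<Longrightarrow> (xbar has_vector_derivative v1 s) (at s within {t0..T})"
    by (rule trajectoryE[OF xbar]) blast
  define N where "N = N0 \<union> N1 \<union> {t0, T}"
  have N: "negligible N"
    using N0(1) N1(1) by (simp add: N_def)
  have "\<forall>s\<in>{t0..T} - N. \<exists>w. (pbar has_vector_derivative w) (at s within {t0..T}) \<and>
      - w \<in> frechet_subdifferential (\<lambda>x. hamiltonian F x (pbar s)) (xbar s) \<and>
      v1 s \<bullet> pbar s = hamiltonian F (xbar s) (pbar s)"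
  proof
    fix s assume s: "s \<in> {t0..T} - N"
    then obtain w v where wv: "(pbar has_vector_derivative w) (at s within {t0..T})"
        "(xbar has_vector_derivative v) (at s within {t0..T})"
        "- w \<in> frechet_subdifferential (\<lambda>x. hamiltonian F x (pbar s)) (xbar s)"
        "v \<in> clarke_gradient (hamiltonian F (xbar s)) (pbar s)"
      using N0(2)[of s] unfolding N_def by blast
    have "t0 < T"
      using s by (auto simp: N_def)
    then have "v = v1 s"
      using vector_derivative_unique_within_closed_interval[of t0 T s xbar v "v1 s"] wv(2) N1(3)[of s] s
      by (simp add: N_def)
    then have "hamiltonian F (xbar s) (pbar s) \<le> v1 s \<bullet> pbar s"
      using clarke_gradient_hamiltonian[of F "xbar s", OF compact_F nonempty_F wv(4)] by simp
    moreover have "v1 s \<bullet> pbar s \<le> hamiltonian F (xbar s) (pbar s)"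
      using hamiltonian_upper[of F "xbar s" "v1 s" "pbar s", OF compact_F] N1(2)[of s] s by (simp add: N_def)
    ultimately show "\<exists>w. (pbar has_vector_derivative w) (at s within {t0..T}) \<and>
        - w \<in> frechet_subdifferential (\<lambda>x. hamiltonian F x (pbar s)) (xbar s) \<and>
        v1 s \<bullet> pbar s = hamiltonian F (xbar s) (pbar s)"
      using wv by (intro exI[of _ w]) simp
  qed
  then obtain w where w: "\<And>s. s \<in> {t0..T} - N \<Longrightarrow> (pbar has_vector_derivative w s) (at s within {t0..T})"
    "\<And>s. s \<in> {t0..T} - N \<Longrightarrow> - w s \<in> frechet_subdifferential (\<lambda>x. hamiltonian F x (pbar s)) (xbar s)"
    and v1H: "\<And>s. s \<in> {t0..T} - N \<Longrightarrow> v1 s \<bullet> pbar s = hamiltonian F (xbar s) (pbar s)"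
    by metis
  define m where "m = L + c / 2"
  have "m \<ge> 0"
    using L(1) \<open>c \<ge> 0\<close> by (simp add: m_def)
  have w_bound: "norm (w s) \<le> m * norm (pbar s)" if s: "s \<in> {t0..T} - N" for s
  proof -
    have "norm (- w s) \<le> L * norm (pbar s) + c * norm (pbar s) / 2"
    proof (rule frechet_subgradient_norm_le[OF semiconvex _ K(2) _ _ w(2)[OF s]])
      fix y assume "y \<in> K"
      then show "hamiltonian F y (pbar s) - hamiltonian F (xbar s) (pbar s) \<le> L * norm (pbar s) * norm (y - xbar s)"
        using hamiltonian_lipschitz_state[of y "xbar s" "pbar s"] xK[of s] s by (simp add: mult_ac)
    qed (use s tube L(1) \<open>c \<ge> 0\<close> in auto)
    then show ?thesis
      by (simp add: m_def algebra_simps)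
  qed
  have pbar_lip: "(m * Rp)-lipschitz_on {t0..T} pbar"
  proof (rule absolutely_continuous_on_lipschitz[OF pbar_ac N _ w(1)])
    fix s assume s: "s \<in> {t0..T} - N"
    have "m * norm (pbar s) \<le> m * Rp"
      using Rp[of s] s \<open>m \<ge> 0\<close> by (intro mult_left_mono) auto
    then show "norm (w s) \<le> m * Rp"
      using w_bound[OF s] by simp
  qed (use \<open>m \<ge> 0\<close> \<open>Rp > 0\<close> in auto)
  have dichotomy: "(\<forall>s\<in>{t0..T}. pbar s \<noteq> 0) \<or> (\<forall>s\<in>{t0..T}. pbar s = 0)"
    using lipschitz_on_vanishing[OF pbar_lip N w(1) w_bound] by blast
  have D: "\<exists>D. GDERIV (hamiltonian F x) p :> D" if "x \<in> K" "p \<noteq> 0" for x p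
    using H_gradient_exists[OF K] that by blast
  obtain G M where "M \<ge> 0"
    and contG: "continuous_on ({t0..T} \<times> K \<times> cball 0 R) (\<lambda>(s, x, v). G s x v)"
    and G: "\<And>s x v. s \<in> {t0..T} \<Longrightarrow> x \<in> K \<Longrightarrow> v \<in> cball 0 R \<Longrightarrow>
      G s x v \<in> F x \<and> G s x v \<bullet> pbar s = hamiltonian F x (pbar s)"
    and lipG: "\<And>s x y v. s \<in> {t0..T} \<Longrightarrow> x \<in> K \<Longrightarrow> y \<in> K \<Longrightarrow> v \<in> F x \<Longrightarrow>
      v \<bullet> pbar s = hamiltonian F x (pbar s) \<Longrightarrow> norm (G s y v - v) \<le> M * norm (x - y)"
    by (rule maximizer_selection[OF convex_F lipschitz_on_continuous_on[OF pbar_lip] dichotomy D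
          H_gradient_lipschitz[OF K]]) blast+
  define v0 where "v0 s = (if s \<in> {t0..T} - N then v1 s
    else SOME v. v \<in> F (xbar s) \<and> v \<bullet> pbar s = hamiltonian F (xbar s) (pbar s))" for s
  have v0: "v0 s \<in> F (xbar s) \<and> v0 s \<bullet> pbar s = hamiltonian F (xbar s) (pbar s)" for s
  proof (cases "s \<in> {t0..T} - N")
    case True
    then show ?thesis
      using N1(2)[of s] v1H[of s] by (simp add: v0_def N_def)
  next
    case False
    obtain v where v: "v \<in> F (xbar s)" "v \<bullet> pbar s = hamiltonian F (xbar s) (pbar s)"
      by (rule hamiltonian_attained[of F "xbar s", OF compact_F nonempty_F])
    have "v0 s = (SOME v. v \<in> F (xbar s) \<and> v \<bullet> pbar s = hamiltonian F (xbar s) (pbar s))"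
      using False by (simp only: v0_def if_False)
    then show ?thesis
      using v by (metis (mono_tags, lifting) someI_ex)
  qed
  have v0_integral: "(v0 has_integral (xbar s - xbar t)) {t..s}" if "t0 \<le> t" "t \<le> s" "s \<le> T" for s t
  proof (rule absolutely_continuous_on_has_integral[OF that(2) _ N])
    show "absolutely_continuous_on t s xbar"
      using absolutely_continuous_on_subinterval[OF xbar_ac] that by simp
    fix u assume u: "u \<in> {t..s} - N"
    then have "(xbar has_vector_derivative v1 u) (at u within {t0..T})"
      using N1(3)[of u] that by (simp add: N_def)
    moreover have "v0 u = v1 u"
      using u that by (simp add: v0_def)
    ultimately show "(xbar has_vector_derivative v0 u) (at u within {t..s})"
      using that by (auto intro: has_vector_derivative_within_subset)
  qed
  define C where "C = c * Rp / 2"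
  have "C \<ge> 0"
    using \<open>c \<ge> 0\<close> \<open>Rp > 0\<close> by (simp add: C_def)
  have below: "hamiltonian F y (pbar s) - hamiltonian F (xbar s) (pbar s)
      \<ge> - w s \<bullet> (y - xbar s) - C * (norm (y - xbar s))\<^sup>2" if s: "s \<in> {t0..T} - N" and "y \<in> K" for s y
  proof -
    have "hamiltonian F y (pbar s) - hamiltonian F (xbar s) (pbar s)
        \<ge> - w s \<bullet> (y - xbar s) - c * norm (pbar s) / 2 * (norm (y - xbar s))\<^sup>2"
      by (rule semiconvex_on_frechet_subdifferential[OF semiconvex _ K(2) xK that(2) w(2)[OF s]])
        (use s \<open>c \<ge> 0\<close> in auto)
    moreover have "c * norm (pbar s) / 2 * (norm (y - xbar s))\<^sup>2 \<le> C * (norm (y - xbar s))\<^sup>2"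
      using Rp[of s] s \<open>c \<ge> 0\<close> unfolding C_def by (intro mult_right_mono divide_right_mono mult_left_mono) auto
    ultimately show ?thesis
      by linarith
  qed
  obtain c\<phi> \<rho>\<phi> where "\<rho>\<phi> > 0" and \<phi>: "\<And>y. y \<in> cball (xbar T) \<rho>\<phi> \<Longrightarrow>
      \<phi> y - \<phi> (xbar T) - (- pbar T) \<bullet> (y - xbar T) \<le> c\<phi> * (norm (y - xbar T))\<^sup>2"
    using transversality unfolding proximal_superdifferential_def by blast
  define E where "E = exp (M * (T - t0))"
  have "E > 0"
    by (simp add: E_def)
  define r where "r = min 1 \<rho>\<phi> / E"
  define c0 where "c0 = C * E\<^sup>2 * (T - t0) + \<bar>c\<phi>\<bar> * E\<^sup>2 + 1"
  have "r > 0"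
    using \<open>E > 0\<close> \<open>\<rho>\<phi> > 0\<close> by (simp add: r_def)
  have "c0 > 0"
    using \<open>C \<ge> 0\<close> t0T unfolding c0_def by (intro add_nonneg_pos add_nonneg_nonneg mult_nonneg_nonneg) auto
  have main: "value_function F \<phi> T t (xbar t + h) - value_function F \<phi> T t (xbar t)
      \<le> (- pbar t) \<bullet> h + c0 * (norm h)\<^sup>2" if t: "t \<in> {t0..T}" and "h \<in> cball 0 r" for t h
  proof -
    define \<eta> where "\<eta> = norm h * exp (M * (T - t))"
    have "\<eta> \<ge> 0"
      by (simp add: \<eta>_def)
    have \<eta>E: "\<eta> \<le> norm h * E"
      using t \<open>M \<ge> 0\<close> unfolding \<eta>_def E_def by (intro mult_left_mono) (auto intro: mult_left_mono)
    also have "\<dots> \<le> min 1 \<rho>\<phi>"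
      using that(2) \<open>E > 0\<close> by (simp only: mem_cball_0 r_def pos_le_divide_eq)
    finally have \<eta>r: "\<eta> \<le> 1" "\<eta> \<le> \<rho>\<phi>"
      by auto
    have sub: "{t..T} \<subseteq> {t0..T}"
      using t by auto
    obtain y where y: "trajectory F T t (xbar t + h) y" "norm (y T - xbar T) \<le> \<eta>"
      "- pbar T \<bullet> (y T - xbar T) \<le> - pbar t \<bullet> h + C * \<eta>\<^sup>2 * (T - t)"
      unfolding \<eta>_def
    proof (rule perturbed_trajectory[of t T M C xbar 1 h "m * Rp" pbar N w v0 G])
      show "norm h * exp (M * (T - t)) \<le> 1"
        using \<eta>r by (simp add: \<eta>_def)
      show "(pbar has_vector_derivative w s) (at s within {t..T})" if "s \<in> {t..T} - N" for s
        by (rule has_vector_derivative_within_subset[OF w(1) sub]) (use that sub in auto)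
      show "continuous_on ({t..T} \<times> K \<times> cball 0 R) (\<lambda>(s, x, v). G s x v)"
        by (rule continuous_on_subset[OF contG]) (use sub in auto)
      show "(m * Rp)-lipschitz_on {t..T} pbar"
        by (rule lipschitz_on_subset[OF pbar_lip sub])
      show "cball (xbar s) 1 \<subseteq> K" if "s \<in> {t..T}" for s
        using that sub tube by blast
      show "(v0 has_integral (xbar s - xbar t)) {t..s}" if "s \<in> {t..T}" for s
        using v0_integral[of t s] t that by simp
    qed (use t \<open>M \<ge> 0\<close> \<open>C \<ge> 0\<close> N v0 G lipG below sub in auto)
    have "value_function F \<phi> T t (xbar t + h) \<le> \<phi> (y T)"
      using value_function_le[of F \<rho> t T \<phi>, OF growth \<open>\<rho> > 0\<close> _ \<phi>_lipschitz y(1)] t by simp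
    moreover have "value_function F \<phi> T t (xbar t) = \<phi> (xbar T)"
      by (rule value_function_optimal_solution[of F \<rho>, OF growth \<open>\<rho> > 0\<close> optimal t])
    moreover have "\<phi> (y T) - \<phi> (xbar T) - (- pbar T) \<bullet> (y T - xbar T) \<le> c\<phi> * (norm (y T - xbar T))\<^sup>2"
      using y(2) \<eta>r by (intro \<phi>) (simp add: dist_norm norm_minus_commute)
    moreover have "c\<phi> * (norm (y T - xbar T))\<^sup>2 \<le> \<bar>c\<phi>\<bar> * \<eta>\<^sup>2"
      using y(2) by (intro mult_mono power_mono) auto
    moreover have "C * \<eta>\<^sup>2 * (T - t) + \<bar>c\<phi>\<bar> * \<eta>\<^sup>2 \<le> c0 * (norm h)\<^sup>2"
    proof -
      have "C * \<eta>\<^sup>2 * (T - t) + \<bar>c\<phi>\<bar> * \<eta>\<^sup>2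
          \<le> C * (norm h * E)\<^sup>2 * (T - t0) + \<bar>c\<phi>\<bar> * (norm h * E)\<^sup>2"
        using \<eta>E \<open>\<eta> \<ge> 0\<close> \<open>C \<ge> 0\<close> t by (intro add_mono mult_mono mult_left_mono power_mono) auto
      also have "\<dots> = (c0 - 1) * (norm h)\<^sup>2"
        by (simp add: c0_def power_mult_distrib algebra_simps)
      also have "\<dots> \<le> c0 * (norm h)\<^sup>2"
        by (intro mult_right_mono) auto
      finally show ?thesis .
    qed
    ultimately show ?thesis
      using y(3) by linarith
  qed
  show ?thesis
  proof (intro conjI ballI)
    show "\<exists>c0>0. \<exists>r>0. \<forall>t\<in>{t0..T}. \<forall>h\<in>cball 0 r.
        value_function F \<phi> T t (xbar t + h) - value_function F \<phi> T t (xbar t)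
          \<le> (- pbar t) \<bullet> h + c0 * (norm h)\<^sup>2"
      using main \<open>c0 > 0\<close> \<open>r > 0\<close> by blast
    fix t assume t: "t \<in> {t0..T}"
    have "value_function F \<phi> T t y - value_function F \<phi> T t (xbar t) - (- pbar t) \<bullet> (y - xbar t)
        \<le> c0 * (norm (y - xbar t))\<^sup>2" if "y \<in> cball (xbar t) r" for y
      using main[OF t, of "y - xbar t"] that by (simp add: dist_norm norm_minus_commute)
    then show "- pbar t \<in> proximal_superdifferential (value_function F \<phi> T t) (xbar t)"
      unfolding proximal_superdifferential_def using \<open>r > 0\<close> by blast
  qed
qed

end
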